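(* For every initial condition $(\mathbf{x}(0),\dot{\mathbf{x}}(0))$, let $s_U^*$ be the optimal value of the upper bound problem and $s^*$ the optimal value of the jobshop scheduling problem (both defined in the context for that initial condition). If $s_U^*=0$, then $s^*=0$.
   Context: **Vehicles.** There are $n$ vehicles. Vehicle $j\in\{1,\ldots,n\}$ has position $x_j\in X_j\subseteq\mathbb{R}$ along its predefined longitudinal path and speed $\dot{x}_j\in\dot{X}_j=[\dot{x}_{j,min},\dot{x}_{j,max}]\subset\mathbb{R}$ with $\dot{x}_{j,min}>0$, and dynamics $\ddot{x}_j=f_j(x_j,\dot{x}_j,u_j)$ with input $u_j\in U_j=[u_{j,min},u_{j,max}]\subset\mathbb{R}$. Input signals $u_j(\cdot):t\mapsto u_j(t)\in U_j$ lie in a signal space $\mathcal{U}_j$. $x_j(t,u_j(\cdot),x_j(0),\dot{x}_j(0))$ and $\dot{x}_j(t,u_j(\cdot),x_j(0),\dot{x}_j(0))$ are the position and speed at time $t$ starting from $(x_j(0),\dot{x}_j(0))$ under $u_j(\cdot)$; likewise $x_j(t,u_j(\cdot),a,b)$ starts from position $a$ with speed $b$. Boldface denotes the aggregate over $j$: $\mathbf{x}=(x_1,\ldots,x_n)\in\mathbf{X}$, $\dot{\mathbf{x}}\in\dot{\mathbf{X}}$, $\mathbf{u}\in\mathbf{U}$, $\mathbf{u}(\cdot)\in\mathcal{U}$. Assumption 1: for all $j$, $x_j(t,u_j(\cdot),x_j(0),\dot{x}_j(0))$ depends continuously on $u_j(\cdot)\in\mathcal{U}_j$, and $\mathcal{U}_j$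 is path-connected. Assumption 2 (monotonicity): write $u_j(\cdot)\le u_j'(\cdot)$ if $u_j(t)\le u_j'(t)$ for all $t\ge0$. For all $j$, if $u_j(\cdot)\le u'_j(\cdot)$, $x_j(0)\le x'_j(0)$, $\dot{x}_j(0)\le\dot{x}'_j(0)$ and $0\le t\le t'$, then $x_j(t,u_j(\cdot),x_j(0),\dot{x}_j(0))\le x_j(t',u'_j(\cdot),x'_j(0),\dot{x}'_j(0))$. **Intersection and operations.** The intersection is a collection of $m$ conflict areas; conflict area $i$ occupies the open interval $(\alpha_{ij},\beta_{ij})\subset\mathbb{R}$ on the path of vehicle $j$ (if it lies on that path). $\bar{\mathcal{N}}$ is the set of operations $(i,j)\in\{1,\ldots,m\}\times\{1,\ldots,n\}$ such that conflict area $i$ is on the route of vehicle $j$. Given $\mathbf{x}(0)$, $\mathcal{N}=\{(i,j)\in\bar{\mathcal{N}}: x_j(0)<\beta_{ij}\}$. $\mathcal{F}\subseteq\mathcal{N}$ (resp. $\mathcal{L}\subseteq\mathcal{N}$) is the set of operations $(i,j)\in\mathcal{N}$ that are the first (resp. last) operation of vehicle $j$ in $\mathcal{N}$. The conjunctive arcs $\mathcal{C}$ are the arcs $(i,j)\to(i',j)$ between operations in $\mathcal{N}$ such that vehicle $j$ crosses conflict area $i$ and then, next, conflict area $i'$ (so $\beta_{ij}\le\alpha_{i'j}$). The disjunctive arcs $\mathcal{D}$ are the arcs $(i,j)\leftrightarrow(i,j')$ between operations in $\mathcal{N}$ with $j\ne j'$ (vehicles $j$ and $j'$ share conflict area $i$).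 **Jobshop scheduling problem.** A schedule is $\mathbf{T}=\{T_{ij}:(i,j)\in\mathcal{N}\}$, where $T_{ij}$ is the time at which vehicle $j$ enters conflict area $i$, i.e. $x_j(T_{ij},u_j(\cdot),x_j(0),\dot{x}_j(0))=\alpha_{ij}$ for some $u_j(\cdot)\in\mathcal{U}_j$ (when $x_j(0)<\alpha_{ij}$). Abbreviate $x_j(t,u_j(\cdot))=x_j(t,u_j(\cdot),x_j(0),\dot{x}_j(0))$. - Release time and deadline, for $(i,j)\in\mathcal{N}\setminus\mathcal{F}$ with $(i',j)\to(i,j)\in\mathcal{C}$: $R_{ij}(\mathbf{T})$ (resp. $D_{ij}(\mathbf{T})$) is the minimum (resp. maximum) over $u_j(\cdot)\in\mathcal{U}_j$ satisfying $x_j(T_{i'j},u_j(\cdot))=\alpha_{i'j}$ of the time $t$ with $x_j(t,u_j(\cdot))=\alpha_{ij}$; if the constraint cannot be satisfied, $R_{ij}=\infty$, $D_{ij}=-\infty$. For $(i,j)\in\mathcal{F}$: if $x_j(0)<\alpha_{ij}$, $R_{ij}$ (resp. $D_{ij}$) is the minimum (resp. maximum) over $u_j(\cdot)\in\mathcal{U}_j$ of the time $t$ with $x_j(t,u_j(\cdot))=\alpha_{ij}$; if $\alpha_{ij}\le x_j(0)$, $R_{ij}=D_{ij}=0$. - Process time: $P_{ij}(\mathbf{T})$ is the minimum over $u_j(\cdot)\in\mathcal{U}_j$ of the time $t$ with $x_j(t,u_j(\cdot))=\beta_{ij}$, subject to the following constraints: for $(i,j)\in\mathcal{N}\setminus\mathcal{L}$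 with $(i,j)\to(i'',j)\in\mathcal{C}$, both $x_j(T_{ij},u_j(\cdot))=\alpha_{ij}$ and $x_j(T_{i''j},u_j(\cdot))=\alpha_{i''j}$ if $x_j(0)<\alpha_{ij}$, and only $x_j(T_{i''j},u_j(\cdot))=\alpha_{i''j}$ if $\alpha_{ij}\le x_j(0)<\beta_{ij}$; for $(i,j)\in\mathcal{L}$, only $x_j(T_{ij},u_j(\cdot))=\alpha_{ij}$ if $x_j(0)<\alpha_{ij}$, and no constraint if $\alpha_{ij}\le x_j(0)<\beta_{ij}$. If the constraints cannot be satisfied, $P_{ij}=\infty$. Then $$s^*=\min_{\mathbf{T},\mathbf{k}}\ \max_{(i,j)\in\mathcal{N}}\big(T_{ij}-D_{ij}(\mathbf{T}),0\big)$$ subject to: $R_{ij}(\mathbf{T})\le T_{ij}$ for all $(i,j)\in\mathcal{N}$; and for all $(i,j)\leftrightarrow(i,j')\in\mathcal{D}$: $P_{ij}(\mathbf{T})\le T_{ij'}+M(1-k_{ijj'})$, $P_{ij'}(\mathbf{T})\le T_{ij}+M(1-k_{ij'j})$, $k_{ijj'}+k_{ij'j}=1$. Here $\mathbf{k}$ is the collection of $k_{ijj'}\in\{0,1\}$ and $M>0$ is a large number (big-M constant). (For all problems here, an infeasible problem has value $+\infty$.) **Upper bound problem.** Let $\alpha_{j,min}=\min_{(i,j)\in\bar{\mathcal{N}}}\alpha_{ij}$. The decision variables are $\mathbf{T}^{\mathcal{F}}=\{T^{\mathcal{F}}_{ij}:(i,j)\in\mathcal{F}\}$, where $x_j(T^{\mathcal{F}}_{ij},u_j(\cdot),x_j(0),\dot{x}_j(0))=\alpha_{ij}$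 for some $u_j(\cdot)\in\mathcal{U}_j$ if $x_j(0)<\alpha_{ij}$, and $T^{\mathcal{F}}_{ij}=0$ otherwise; and $\mathbf{k}=\{k_{ijj'}\in\{0,1\}\}$ for $(i,j)\leftrightarrow(i,j')\in\mathcal{D}$. Write $\tau_j(a,b;c)=\min_{u_j(\cdot)\in\mathcal{U}_j}\{t: x_j(t,u_j(\cdot),a,b)=c\}$. - For $(i,j)\in\mathcal{F}$: if $x_j(0)<\alpha_{j,min}$, $\bar{R}_{ij}=\min_{u_j(\cdot)\in\mathcal{U}_j}\{t:x_j(t,u_j(\cdot),x_j(0),\dot{x}_j(0))=\alpha_{j,min}\}$ and $\bar{D}_{ij}=\max_{u_j(\cdot)\in\mathcal{U}_j}\{t:x_j(t,u_j(\cdot),x_j(0),\dot{x}_j(0))=\alpha_{j,min}\}$; if $\alpha_{j,min}\le x_j(0)<\alpha_{ij}$, $\bar{R}_{ij}=\bar{D}_{ij}=\tau_j(x_j(0),\dot{x}_j(0);\alpha_{ij})$; if $\alpha_{ij}\le x_j(0)$, $\bar{R}_{ij}=\bar{D}_{ij}=0$. - If $x_j(0)<\alpha_{j,min}$: for $(i,j)\in\mathcal{F}$, $\bar{T}_{ij}=T^{\mathcal{F}}_{ij}$, $\bar{P}_{ij}=T^{\mathcal{F}}_{ij}+\tau_j(\alpha_{ij},\dot{x}_{j,min};\beta_{ij})$; for $(i,j)\in\mathcal{N}\setminus\mathcal{F}$, with $(i',j)\in\mathcal{F}$ the first operation of vehicle $j$ (so $\alpha_{i'j}=\alpha_{j,min}$),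 $\bar{T}_{ij}=T^{\mathcal{F}}_{i'j}+\tau_j(\alpha_{j,min},\dot{x}_{j,max};\alpha_{ij})$, $\bar{P}_{ij}=T^{\mathcal{F}}_{i'j}+\tau_j(\alpha_{j,min},\dot{x}_{j,min};\beta_{ij})$. - If $\alpha_{j,min}\le x_j(0)$: for $(i,j)\in\mathcal{F}$, $\bar{T}_{ij}=T^{\mathcal{F}}_{ij}$, $\bar{P}_{ij}=T^{\mathcal{F}}_{ij}-\bar{R}_{ij}+\tau_j(x_j(0),\dot{x}_j(0);\beta_{ij})$; for $(i,j)\in\mathcal{N}\setminus\mathcal{F}$, with $(i',j)\in\mathcal{F}$ the first operation of vehicle $j$, $\bar{T}_{ij}=T^{\mathcal{F}}_{i'j}-\bar{R}_{i'j}+\tau_j(x_j(0),\dot{x}_j(0);\alpha_{ij})$, $\bar{P}_{ij}=T^{\mathcal{F}}_{i'j}-\bar{R}_{i'j}+\tau_j(x_j(0),\dot{x}_j(0);\beta_{ij})$. Then $$s_U^*=\min_{\mathbf{T}^{\mathcal{F}},\mathbf{k}}\ \max_{(i,j)\in\mathcal{F}}\big(T^{\mathcal{F}}_{ij}-\bar{D}_{ij},0\big)$$ subject to: $\bar{R}_{ij}\le T^{\mathcal{F}}_{ij}$ for all $(i,j)\in\mathcal{F}$; and for all $(i,j)\leftrightarrow(i,j')\in\mathcal{D}$: $\bar{P}_{ij}\le\bar{T}_{ij'}+M(1-k_{ijj'})$, $\bar{P}_{ij'}\le\bar{T}_{ij}+M(1-k_{ij'j})$, $k_{ijj'}+k_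{ij'j}=1$.
   Formalization: Added: each signal space contains the constant maximal input and is closed under switching between admissible signals at any time. In R_ij and D_ij the condition x_j(T_{i'j})=α_{i'j} is imposed only if x_j(0)<α_{i'j}. Without these the claim fails. *)

theory Defs
  imports "HOL-Analysis.Analysis"
begin

section \<open>Vehicles\<close>

text \<open>
  Input signals are functions on the reals of which only the values at times \<open>t \<ge> 0\<close> matter.
  The field \<open>signals\<close> is the signal space together with its topology.
  \<open>position V t u a b\<close> and \<open>speed V t u a b\<close> are position and speed at time \<open>t\<close> under the input
  signal \<open>u\<close>, starting from position \<open>a\<close> with speed \<open>b\<close>.
\<close>

record vehicle =
  positions :: "real set"
  speed_min :: real
  speed_max :: real
  input_min :: real
  input_max :: real
  dynamics :: "real \<Rightarrow> real \<Rightarrow> real \<Rightarrow> real"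
  signals :: "(real \<Rightarrow> real) topology"
  position :: "real \<Rightarrow> (real \<Rightarrow> real) \<Rightarrow> real \<Rightarrow> real \<Rightarrow> real"
  speed :: "real \<Rightarrow> (real \<Rightarrow> real) \<Rightarrow> real \<Rightarrow> real \<Rightarrow> real"

definition speeds :: "vehicle \<Rightarrow> real set" where
  "speeds V = {speed_min V..speed_max V}"

definition inputs :: "vehicle \<Rightarrow> real set" where
  "inputs V = {input_min V..input_max V}"

definition signal_set :: "vehicle \<Rightarrow> (real \<Rightarrow> real) set" where
  "signal_set V = topspace (signals V)"

text \<open>
  Since \<open>u\<close> need not be continuous, \<open>x'' = f(x, x', u)\<close> is understood in the sense of
  Caratheodory: the speed \<open>v\<close> is an indefinite Lebesgue integral of the acceleration.
\<close>

definition is_motion ::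
  "vehicle \<Rightarrow> (real \<Rightarrow> real) \<Rightarrow> real \<Rightarrow> real \<Rightarrow> (real \<Rightarrow> real) \<Rightarrow> (real \<Rightarrow> real) \<Rightarrow> bool" where
  "is_motion V u a b x v \<longleftrightarrow>
     x 0 = a \<and> v 0 = b \<and>
     (\<forall>t\<ge>0. x t \<in> positions V \<and> v t \<in> speeds V \<and>
        (x has_real_derivative v t) (at t within {0..}) \<and>
        (\<lambda>s. dynamics V (x s) (v s) (u s)) absolutely_integrable_on {0..t} \<and>
        v t = b + integral {0..t} (\<lambda>s. dynamics V (x s) (v s) (u s)))"

definition switch_signal :: "real \<Rightarrow> (real \<Rightarrow> real) \<Rightarrow> (real \<Rightarrow> real) \<Rightarrow> (real \<Rightarrow> real)" where
  "switch_signal T u w = (\<lambda>t. if t < T then u t else w (t - T))"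

text \<open>
  What is used implicitly when one speaks of a space of control signals: a vehicle may apply its
  maximal input throughout, and may at any time continue with another admissible signal.
\<close>

definition is_signal_space :: "vehicle \<Rightarrow> bool" where
  "is_signal_space V \<longleftrightarrow>
     (\<forall>u\<in>signal_set V. \<forall>t\<ge>0. u t \<in> inputs V) \<and>
     (\<lambda>_. input_max V) \<in> signal_set V \<and>
     (\<forall>u\<in>signal_set V. \<forall>w\<in>signal_set V. \<forall>T\<ge>0. switch_signal T u w \<in> signal_set V)"

text \<open>\<open>position\<close> and \<open>speed\<close> are the unique solution of the equations of motion.\<close>

definition well_posed :: "vehicle \<Rightarrow> bool" where
  "well_posed V \<longleftrightarrow>
     (\<forall>u\<in>signal_set V. \<forall>a\<in>positions V. \<forall>b\<in>speeds V.
        is_motion V u a b (\<lambda>t. position V t u a b) (\<lambda>t. speed V t u a b) \<and>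
        (\<forall>x v. is_motion V u a b x v \<longrightarrow>
           (\<forall>t\<ge>0. x t = position V t u a b \<and> v t = speed V t u a b)))"

definition continuous_in_signal :: "vehicle \<Rightarrow> bool" where
  "continuous_in_signal V \<longleftrightarrow>
     (\<forall>t\<ge>0. \<forall>a\<in>positions V. \<forall>b\<in>speeds V.
        continuous_map (signals V) euclideanreal (\<lambda>u. position V t u a b))"

definition monotone_vehicle :: "vehicle \<Rightarrow> bool" where
  "monotone_vehicle V \<longleftrightarrow>
     (\<forall>u\<in>signal_set V. \<forall>u'\<in>signal_set V.
      \<forall>a\<in>positions V. \<forall>a'\<in>positions V. \<forall>b\<in>speeds V. \<forall>b'\<in>speeds V. \<forall>t t'.
        (\<forall>s\<ge>0. u s \<le> u' s) \<and> a \<le> a' \<and> b \<le> b' \<and> 0 \<le> t \<and> t \<le> t' \<longrightarrow>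
        position V t u a b \<le> position V t' u' a' b')"

definition is_vehicle :: "vehicle \<Rightarrow> bool" where
  "is_vehicle V \<longleftrightarrow>
     0 < speed_min V \<and> speed_min V \<le> speed_max V \<and> input_min V \<le> input_max V \<and>
     is_signal_space V \<and> well_posed V \<and>
     continuous_in_signal V \<and> path_connected_space (signals V) \<and>
     monotone_vehicle V"

definition earliest :: "vehicle \<Rightarrow> (real \<Rightarrow> real) set \<Rightarrow> real \<Rightarrow> real \<Rightarrow> real \<Rightarrow> ereal" where
  "earliest V W a b c = Inf {ereal t | t u. u \<in> W \<and> 0 \<le> t \<and> position V t u a b = c}"

definition latest :: "vehicle \<Rightarrow> (real \<Rightarrow> real) set \<Rightarrow> real \<Rightarrow> real \<Rightarrow> real \<Rightarrow> ereal" where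
  "latest V W a b c = Sup {ereal t | t u. u \<in> W \<and> 0 \<le> t \<and> position V t u a b = c}"

definition reachable_at :: "vehicle \<Rightarrow> real \<Rightarrow> real \<Rightarrow> real \<Rightarrow> real \<Rightarrow> bool" where
  "reachable_at V a b c t \<longleftrightarrow> 0 \<le> t \<and> (\<exists>u\<in>signal_set V. position V t u a b = c)"

definition \<tau> :: "vehicle \<Rightarrow> real \<Rightarrow> real \<Rightarrow> real \<Rightarrow> ereal" where
  "\<tau> V a b c = earliest V (signal_set V) a b c"


section \<open>The intersection and its operations\<close>

text \<open>
  Conflict area \<open>i\<close> occupies the interval \<open>(\<alpha> S i j, \<beta> S i j)\<close> on the path of vehicle \<open>j\<close>, for
  \<open>(i, j)\<close> in \<open>all_ops S\<close>; other values of \<open>\<alpha>\<close> and \<open>\<beta>\<close> are irrelevant.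
\<close>

record intersection =
  num_vehicles :: nat
  num_areas :: nat
  veh :: "nat \<Rightarrow> vehicle"
  all_ops :: "(nat \<times> nat) set"
  \<alpha> :: "nat \<Rightarrow> nat \<Rightarrow> real"
  \<beta> :: "nat \<Rightarrow> nat \<Rightarrow> real"

definition is_intersection :: "intersection \<Rightarrow> bool" where
  "is_intersection S \<longleftrightarrow>
     (\<forall>j\<in>{1..num_vehicles S}. is_vehicle (veh S j)) \<and>
     all_ops S \<subseteq> {1..num_areas S} \<times> {1..num_vehicles S} \<and>
     (\<forall>(i, j)\<in>all_ops S. \<alpha> S i j < \<beta> S i j) \<and>
     (\<forall>i i' j. (i, j) \<in> all_ops S \<and> (i', j) \<in> all_ops S \<and> i \<noteq> i' \<longrightarrow>
        \<beta> S i j \<le> \<alpha> S i' j \<or> \<beta> S i' j \<le> \<alpha> S i j)"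

definition initial_condition ::
  "intersection \<Rightarrow> (nat \<Rightarrow> real) \<Rightarrow> (nat \<Rightarrow> real) \<Rightarrow> bool" where
  "initial_condition S x0 v0 \<longleftrightarrow>
     (\<forall>j\<in>{1..num_vehicles S}. x0 j \<in> positions (veh S j) \<and> v0 j \<in> speeds (veh S j))"

definition ops :: "intersection \<Rightarrow> (nat \<Rightarrow> real) \<Rightarrow> (nat \<times> nat) set" where
  "ops S x0 = {(i, j). (i, j) \<in> all_ops S \<and> x0 j < \<beta> S i j}"

definition first_ops :: "intersection \<Rightarrow> (nat \<Rightarrow> real) \<Rightarrow> (nat \<times> nat) set" where
  "first_ops S x0 =
     {(i, j). (i, j) \<in> ops S x0 \<and> (\<forall>i'. (i', j) \<in> ops S x0 \<longrightarrow> \<alpha> S i j \<le> \<alpha> S i' j)}"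

definition last_ops :: "intersection \<Rightarrow> (nat \<Rightarrow> real) \<Rightarrow> (nat \<times> nat) set" where
  "last_ops S x0 =
     {(i, j). (i, j) \<in> ops S x0 \<and> (\<forall>i'. (i', j) \<in> ops S x0 \<longrightarrow> \<alpha> S i' j \<le> \<alpha> S i j)}"

text \<open>\<open>(i, i', j)\<close> stands for the conjunctive arc \<open>(i, j) \<rightarrow> (i', j)\<close>.\<close>

definition conj_arcs :: "intersection \<Rightarrow> (nat \<Rightarrow> real) \<Rightarrow> (nat \<times> nat \<times> nat) set" where
  "conj_arcs S x0 =
     {(i, i', j). (i, j) \<in> ops S x0 \<and> (i', j) \<in> ops S x0 \<and> \<alpha> S i j < \<alpha> S i' j \<and>
        \<not> (\<exists>l. (l, j) \<in> ops S x0 \<and> \<alpha> S i j < \<alpha> S l j \<and> \<alpha> S l j < \<alpha> S i' j)}"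

text \<open>\<open>(i, j, j')\<close> stands for the disjunctive arc \<open>(i, j) \<leftrightarrow> (i, j')\<close>, listed in both directions.\<close>

definition disj_arcs :: "intersection \<Rightarrow> (nat \<Rightarrow> real) \<Rightarrow> (nat \<times> nat \<times> nat) set" where
  "disj_arcs S x0 = {(i, j, j'). (i, j) \<in> ops S x0 \<and> (i, j') \<in> ops S x0 \<and> j \<noteq> j'}"


section \<open>The jobshop scheduling problem\<close>

text \<open>
  An entry time \<open>T i j\<close> refers to a crossing of \<open>\<alpha> S i j\<close> only if \<open>x0 j < \<alpha> S i j\<close>. A vehicle that
  starts inside its first conflict area never crosses the entry of that area, so the entry time of
  that area imposes no constraint on its input signal, neither on the way to the next conflict
  area nor on the way to the exit.
\<close>

definition meets_entry ::
  "intersection \<Rightarrow> (nat \<Rightarrow> real) \<Rightarrow> (nat \<Rightarrow> real) \<Rightarrow> (nat \<Rightarrow> nat \<Rightarrow> real) \<Rightarrow>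
   nat \<Rightarrow> nat \<Rightarrow> (real \<Rightarrow> real) \<Rightarrow> bool" where
  "meets_entry S x0 v0 T i j u \<longleftrightarrow>
     (x0 j < \<alpha> S i j \<longrightarrow> position (veh S j) (T i j) u (x0 j) (v0 j) = \<alpha> S i j)"

definition signals_from_pred ::
  "intersection \<Rightarrow> (nat \<Rightarrow> real) \<Rightarrow> (nat \<Rightarrow> real) \<Rightarrow> (nat \<Rightarrow> nat \<Rightarrow> real) \<Rightarrow>
   nat \<Rightarrow> nat \<Rightarrow> (real \<Rightarrow> real) set" where
  "signals_from_pred S x0 v0 T i j =
     {u \<in> signal_set (veh S j).
        \<forall>i'. (i', i, j) \<in> conj_arcs S x0 \<longrightarrow> meets_entry S x0 v0 T i' j u}"

definition release_time ::
  "intersection \<Rightarrow> (nat \<Rightarrow> real) \<Rightarrow> (nat \<Rightarrow> real) \<Rightarrow> (nat \<Rightarrow> nat \<Rightarrow> real) \<Rightarrow>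
   nat \<Rightarrow> nat \<Rightarrow> ereal" where
  "release_time S x0 v0 T i j =
     (if (i, j) \<notin> first_ops S x0 then
        earliest (veh S j) (signals_from_pred S x0 v0 T i j) (x0 j) (v0 j) (\<alpha> S i j)
      else if x0 j < \<alpha> S i j then
        earliest (veh S j) (signal_set (veh S j)) (x0 j) (v0 j) (\<alpha> S i j)
      else 0)"

definition deadline ::
  "intersection \<Rightarrow> (nat \<Rightarrow> real) \<Rightarrow> (nat \<Rightarrow> real) \<Rightarrow> (nat \<Rightarrow> nat \<Rightarrow> real) \<Rightarrow>
   nat \<Rightarrow> nat \<Rightarrow> ereal" where
  "deadline S x0 v0 T i j =
     (if (i, j) \<notin> first_ops S x0 then
        latest (veh S j) (signals_from_pred S x0 v0 T i j) (x0 j) (v0 j) (\<alpha> S i j)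
      else if x0 j < \<alpha> S i j then
        latest (veh S j) (signal_set (veh S j)) (x0 j) (v0 j) (\<alpha> S i j)
      else 0)"

definition process_time ::
  "intersection \<Rightarrow> (nat \<Rightarrow> real) \<Rightarrow> (nat \<Rightarrow> real) \<Rightarrow> (nat \<Rightarrow> nat \<Rightarrow> real) \<Rightarrow>
   nat \<Rightarrow> nat \<Rightarrow> ereal" where
  "process_time S x0 v0 T i j =
     earliest (veh S j)
       (if (i, j) \<notin> last_ops S x0 then
          {u \<in> signal_set (veh S j). meets_entry S x0 v0 T i j u \<and>
             (\<forall>l. (i, l, j) \<in> conj_arcs S x0 \<longrightarrow>
                position (veh S j) (T l j) u (x0 j) (v0 j) = \<alpha> S l j)}
        else {u \<in> signal_set (veh S j). meets_entry S x0 v0 T i j u})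
       (x0 j) (v0 j) (\<beta> S i j)"

definition is_schedule ::
  "intersection \<Rightarrow> (nat \<Rightarrow> real) \<Rightarrow> (nat \<Rightarrow> real) \<Rightarrow> (nat \<Rightarrow> nat \<Rightarrow> real) \<Rightarrow> bool" where
  "is_schedule S x0 v0 T \<longleftrightarrow>
     (\<forall>(i, j)\<in>ops S x0. x0 j < \<alpha> S i j \<longrightarrow>
        reachable_at (veh S j) (x0 j) (v0 j) (\<alpha> S i j) (T i j))"

definition is_order ::
  "intersection \<Rightarrow> (nat \<Rightarrow> real) \<Rightarrow> (nat \<Rightarrow> nat \<Rightarrow> nat \<Rightarrow> nat) \<Rightarrow> bool" where
  "is_order S x0 k \<longleftrightarrow>
     (\<forall>(i, j, j')\<in>disj_arcs S x0. k i j j' \<in> {0, 1} \<and> k i j j' + k i j' j = 1)"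

definition jobshop_feasible ::
  "intersection \<Rightarrow> real \<Rightarrow> (nat \<Rightarrow> real) \<Rightarrow> (nat \<Rightarrow> real) \<Rightarrow> (nat \<Rightarrow> nat \<Rightarrow> real) \<Rightarrow>
   (nat \<Rightarrow> nat \<Rightarrow> nat \<Rightarrow> nat) \<Rightarrow> bool" where
  "jobshop_feasible S M x0 v0 T k \<longleftrightarrow>
     is_schedule S x0 v0 T \<and> is_order S x0 k \<and>
     (\<forall>(i, j)\<in>ops S x0. release_time S x0 v0 T i j \<le> ereal (T i j)) \<and>
     (\<forall>(i, j, j')\<in>disj_arcs S x0.
        process_time S x0 v0 T i j \<le> ereal (T i j' + M * (1 - real (k i j j'))) \<and>
        process_time S x0 v0 T i j' \<le> ereal (T i j + M * (1 - real (k i j' j))))"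

definition jobshop_objective ::
  "intersection \<Rightarrow> (nat \<Rightarrow> real) \<Rightarrow> (nat \<Rightarrow> real) \<Rightarrow> (nat \<Rightarrow> nat \<Rightarrow> real) \<Rightarrow> ereal" where
  "jobshop_objective S x0 v0 T =
     Max (insert 0 ((\<lambda>(i, j). ereal (T i j) - deadline S x0 v0 T i j) ` ops S x0))"

text \<open>Optimal values are infima in \<^typ>\<open>ereal\<close>, so that an infeasible problem has value \<open>\<infinity>\<close>.\<close>

definition s_star :: "intersection \<Rightarrow> real \<Rightarrow> (nat \<Rightarrow> real) \<Rightarrow> (nat \<Rightarrow> real) \<Rightarrow> ereal" where
  "s_star S M x0 v0 =
     Inf {jobshop_objective S x0 v0 T | T k. jobshop_feasible S M x0 v0 T k}"


section \<open>The upper bound problem\<close>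

definition \<alpha>_min :: "intersection \<Rightarrow> nat \<Rightarrow> real" where
  "\<alpha>_min S j = Min {\<alpha> S i j | i. (i, j) \<in> all_ops S}"

definition first_area :: "intersection \<Rightarrow> (nat \<Rightarrow> real) \<Rightarrow> nat \<Rightarrow> nat" where
  "first_area S x0 j = (THE i. (i, j) \<in> first_ops S x0)"

definition R_bar ::
  "intersection \<Rightarrow> (nat \<Rightarrow> real) \<Rightarrow> (nat \<Rightarrow> real) \<Rightarrow> nat \<Rightarrow> nat \<Rightarrow> ereal" where
  "R_bar S x0 v0 i j =
     (if x0 j < \<alpha>_min S j then
        earliest (veh S j) (signal_set (veh S j)) (x0 j) (v0 j) (\<alpha>_min S j)
      else if x0 j < \<alpha> S i j then \<tau> (veh S j) (x0 j) (v0 j) (\<alpha> S i j)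
      else 0)"

definition D_bar ::
  "intersection \<Rightarrow> (nat \<Rightarrow> real) \<Rightarrow> (nat \<Rightarrow> real) \<Rightarrow> nat \<Rightarrow> nat \<Rightarrow> ereal" where
  "D_bar S x0 v0 i j =
     (if x0 j < \<alpha>_min S j then
        latest (veh S j) (signal_set (veh S j)) (x0 j) (v0 j) (\<alpha>_min S j)
      else if x0 j < \<alpha> S i j then \<tau> (veh S j) (x0 j) (v0 j) (\<alpha> S i j)
      else 0)"

definition T_bar ::
  "intersection \<Rightarrow> (nat \<Rightarrow> real) \<Rightarrow> (nat \<Rightarrow> real) \<Rightarrow> (nat \<Rightarrow> nat \<Rightarrow> real) \<Rightarrow>
   nat \<Rightarrow> nat \<Rightarrow> ereal" where
  "T_bar S x0 v0 TF i j =
     (if (i, j) \<in> first_ops S x0 then ereal (TF i j)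
      else let i' = first_area S x0 j in
        if x0 j < \<alpha>_min S j then
          ereal (TF i' j) + \<tau> (veh S j) (\<alpha>_min S j) (speed_max (veh S j)) (\<alpha> S i j)
        else
          ereal (TF i' j) - R_bar S x0 v0 i' j + \<tau> (veh S j) (x0 j) (v0 j) (\<alpha> S i j))"

definition P_bar ::
  "intersection \<Rightarrow> (nat \<Rightarrow> real) \<Rightarrow> (nat \<Rightarrow> real) \<Rightarrow> (nat \<Rightarrow> nat \<Rightarrow> real) \<Rightarrow>
   nat \<Rightarrow> nat \<Rightarrow> ereal" where
  "P_bar S x0 v0 TF i j =
     (if x0 j < \<alpha>_min S j then
        if (i, j) \<in> first_ops S x0 then
          ereal (TF i j) + \<tau> (veh S j) (\<alpha> S i j) (speed_min (veh S j)) (\<beta> S i j)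
        else
          ereal (TF (first_area S x0 j) j)
            + \<tau> (veh S j) (\<alpha>_min S j) (speed_min (veh S j)) (\<beta> S i j)
      else
        if (i, j) \<in> first_ops S x0 then
          ereal (TF i j) - R_bar S x0 v0 i j + \<tau> (veh S j) (x0 j) (v0 j) (\<beta> S i j)
        else
          ereal (TF (first_area S x0 j) j) - R_bar S x0 v0 (first_area S x0 j) j
            + \<tau> (veh S j) (x0 j) (v0 j) (\<beta> S i j))"

definition is_first_schedule ::
  "intersection \<Rightarrow> (nat \<Rightarrow> real) \<Rightarrow> (nat \<Rightarrow> real) \<Rightarrow> (nat \<Rightarrow> nat \<Rightarrow> real) \<Rightarrow> bool" where
  "is_first_schedule S x0 v0 TF \<longleftrightarrow>
     (\<forall>(i, j)\<in>first_ops S x0.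
        if x0 j < \<alpha> S i j then reachable_at (veh S j) (x0 j) (v0 j) (\<alpha> S i j) (TF i j)
        else TF i j = 0)"

definition upper_feasible ::
  "intersection \<Rightarrow> real \<Rightarrow> (nat \<Rightarrow> real) \<Rightarrow> (nat \<Rightarrow> real) \<Rightarrow> (nat \<Rightarrow> nat \<Rightarrow> real) \<Rightarrow>
   (nat \<Rightarrow> nat \<Rightarrow> nat \<Rightarrow> nat) \<Rightarrow> bool" where
  "upper_feasible S M x0 v0 TF k \<longleftrightarrow>
     is_first_schedule S x0 v0 TF \<and> is_order S x0 k \<and>
     (\<forall>(i, j)\<in>first_ops S x0. R_bar S x0 v0 i j \<le> ereal (TF i j)) \<and>
     (\<forall>(i, j, j')\<in>disj_arcs S x0.
        P_bar S x0 v0 TF i j \<le> T_bar S x0 v0 TF i j' + ereal (M * (1 - real (k i j j'))) \<and>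
        P_bar S x0 v0 TF i j' \<le> T_bar S x0 v0 TF i j + ereal (M * (1 - real (k i j' j))))"

definition upper_objective ::
  "intersection \<Rightarrow> (nat \<Rightarrow> real) \<Rightarrow> (nat \<Rightarrow> real) \<Rightarrow> (nat \<Rightarrow> nat \<Rightarrow> real) \<Rightarrow> ereal" where
  "upper_objective S x0 v0 TF =
     Max (insert 0 ((\<lambda>(i, j). ereal (TF i j) - D_bar S x0 v0 i j) ` first_ops S x0))"

definition s_U_star :: "intersection \<Rightarrow> real \<Rightarrow> (nat \<Rightarrow> real) \<Rightarrow> (nat \<Rightarrow> real) \<Rightarrow> ereal" where
  "s_U_star S M x0 v0 =
     Inf {upper_objective S x0 v0 TF | TF k. upper_feasible S M x0 v0 TF k}"

end

theory Submission
  imports Defs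
begin

text \<open>
  The objective of the jobshop problem measures how far a schedule is from being driven by actual
  vehicles: if for each vehicle the entry times are all read off from one trajectory, then every
  entry time lies between its release time and its deadline, and every process time is at most the
  exit time of that trajectory. So for the value \<open>0\<close> it is enough to find one trajectory for each
  vehicle such that their entry and exit times satisfy the disjunctive constraints. A solution of
  value \<open>0\<close> of the upper bound problem yields such trajectories.

  A vehicle with \<open>x0 j < \<alpha>_min S j\<close> is driven so that it reaches \<open>\<alpha>_min S j\<close> exactly at its
  scheduled time, and from then on at maximal input. This is possible because signals may be
  switched and, by uniqueness of the solution of the equations of motion, a switched trajectory
  restarts from the state that it had reached (lemma \<open>position_switch_signal\<close>). The speed at
  \<open>\<alpha>_min S j\<close> is unknown, but it lies between the minimal and the maximal speed; by monotonicity
  the later entry times are no earlier than \<open>T_bar\<close>, which assumes the maximal speed, and the exit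
  times are no later than \<open>P_bar\<close>, which assumes the minimal speed (lemma
  \<open>crossing_time_continue_at_max_input\<close>). Every other vehicle uses the maximal input throughout.
  For it release time and deadline of the upper bound problem coincide, so value \<open>0\<close> forces its
  scheduled time to be the one attained at maximal input, and \<open>T_bar\<close>, \<open>P_bar\<close> are then exactly
  the entry and exit times of that trajectory. Hence the disjunctive constraints of the upper bound
  problem carry over to the jobshop problem, with the same order and the same big-M constant
  (lemmas \<open>realising_signal\<close> and \<open>jobshop_optimum_of_upper_bound\<close>).

  This argument starts from a solution of value \<open>0\<close>, whereas \<open>s_U_star\<close> is an infimum, and the set
  of reachable times need not be closed from above. The infimum is attained nevertheless. There
  are only finitely many orders, so one of them admits solutions of arbitrarily small objective
  value. For a fixed order the constraints have the form \<open>t j + c \<le> t j'\<close>, and such systems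
  are closed under pointwise infima. The pointwise infimum of all feasible schedules for that order
  is therefore feasible; its times are reachable because the reachable times form an interval that contains its lower end (lemma
  \<open>reachable_times_interval\<close>, from the continuity and path-connectedness assumption). It meets all
  deadlines (lemmas \<open>upper_feasible_pointwise_Inf\<close> and \<open>upper_bound_attained\<close>).
\<close>

section \<open>Motion of a single vehicle\<close>

lemma is_vehicleD:
  assumes "is_vehicle V"
  shows "0 < speed_min V" "speed_min V \<le> speed_max V" "is_signal_space V" "well_posed V"
    "continuous_in_signal V" "path_connected_space (signals V)" "monotone_vehicle V"
  using assms by (auto simp: is_vehicle_def)

definition max_input_signal :: "vehicle \<Rightarrow> real \<Rightarrow> real" where
  "max_input_signal V = (\<lambda>_. input_max V)"

definition is_state :: "vehicle \<Rightarrow> real \<Rightarrow> real \<Rightarrow> bool" where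
  "is_state V a b \<longleftrightarrow> a \<in> positions V \<and> b \<in> speeds V"

lemma max_input_signal_in_signal_set:
  "is_vehicle V \<Longrightarrow> max_input_signal V \<in> signal_set V"
  by (auto simp: is_vehicle_def is_signal_space_def max_input_signal_def)

lemma signal_le_max_input:
  "is_vehicle V \<Longrightarrow> u \<in> signal_set V \<Longrightarrow> 0 \<le> t \<Longrightarrow> u t \<le> max_input_signal V t"
  by (auto simp: is_vehicle_def is_signal_space_def max_input_signal_def inputs_def)

lemma switch_signal_in_signal_set:
  "is_vehicle V \<Longrightarrow> u \<in> signal_set V \<Longrightarrow> w \<in> signal_set V \<Longrightarrow> 0 \<le> T \<Longrightarrow>
    switch_signal T u w \<in> signal_set V"
  by (auto simp: is_vehicle_def is_signal_space_def)

lemma extreme_speeds: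
  assumes "is_vehicle V"
  shows "speed_min V \<in> speeds V" "speed_max V \<in> speeds V"
  using is_vehicleD[OF assms] by (auto simp: speeds_def)

lemma is_motion_position:
  "is_vehicle V \<Longrightarrow> u \<in> signal_set V \<Longrightarrow> is_state V a b \<Longrightarrow>
    is_motion V u a b (\<lambda>t. position V t u a b) (\<lambda>t. speed V t u a b)"
  by (auto simp: is_vehicle_def well_posed_def is_state_def)

lemma motion_unique:
  "is_vehicle V \<Longrightarrow> u \<in> signal_set V \<Longrightarrow> is_state V a b \<Longrightarrow> is_motion V u a b x v \<Longrightarrow> 0 \<le> t \<Longrightarrow>
    x t = position V t u a b"
  unfolding is_vehicle_def well_posed_def is_state_def by blast

text \<open>
  The integral equation expresses \<open>v\<close> by itself and makes rewriting with the definition of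
  \<open>is_motion\<close> diverge, hence these rules.
\<close>

lemma is_motionD:
  assumes "is_motion V u a b x v"
  shows "x 0 = a" "v 0 = b"
    and "0 \<le> t \<Longrightarrow> is_state V (x t) (v t)"
    and "0 \<le> t \<Longrightarrow> (x has_real_derivative v t) (at t within {0..})"
    and "0 \<le> t \<Longrightarrow>
      (\<lambda>s. dynamics V (x s) (v s) (u s)) absolutely_integrable_on {0..t}"
    and "0 \<le> t \<Longrightarrow> v t = b + integral {0..t} (\<lambda>s. dynamics V (x s) (v s) (u s))"
  using assms unfolding is_motion_def is_state_def by blast+

lemma state_position:
  "is_vehicle V \<Longrightarrow> u \<in> signal_set V \<Longrightarrow> is_state V a b \<Longrightarrow> 0 \<le> t \<Longrightarrow>
    is_state V (position V t u a b) (speed V t u a b)"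
  using is_motionD(3) is_motion_position by blast

lemma position_0:
  "is_vehicle V \<Longrightarrow> u \<in> signal_set V \<Longrightarrow> is_state V a b \<Longrightarrow> position V 0 u a b = a"
  using is_motionD(1)[OF is_motion_position] .

lemma continuous_on_position:
  assumes "is_vehicle V" "u \<in> signal_set V" "is_state V a b"
  shows "continuous_on {0..} (\<lambda>t. position V t u a b)"
proof (rule DERIV_continuous_on)
  fix t :: real
  assume "t \<in> {0..}"
  then show "((\<lambda>t. position V t u a b) has_field_derivative speed V t u a b) (at t within {0..})"
    using is_motionD(4)[OF is_motion_position[OF assms]] by simp
qed

text \<open>
  By the mean value theorem: the derivative of the position is a speed, hence at least
  \<open>speed_min V\<close>. As the minimal speed is positive, a vehicle reaches every position ahead of it
  exactly once, which makes \<open>crossing_time\<close> below well defined.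
\<close>

lemma position_advances:
  assumes V: "is_vehicle V" and u: "u \<in> signal_set V" and ab: "is_state V a b"
    and st: "0 \<le> s" "s \<le> t"
  shows "position V s u a b + speed_min V * (t - s) \<le> position V t u a b"
proof (cases "s = t")
  case False
  define x v where "x = (\<lambda>t. position V t u a b)" and "v = (\<lambda>t. speed V t u a b)"
  have m: "is_motion V u a b x v"
    unfolding x_def v_def by (rule is_motion_position[OF V u ab])
  have "(x has_derivative (*) (v r)) (at r within {s..t})" if "r \<in> {s..t}" for r
  proof -
    have "(x has_real_derivative v r) (at r within {0..})"
      using is_motionD(4)[OF m] that st by simp
    then have "(x has_real_derivative v r) (at r within {s..t})"
      by (rule DERIV_subset) (use st in auto)
    then show ?thesis by (simp add: has_field_derivative_def)
  qed
  moreover have "s < t" using False st by simp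
  ultimately have "\<exists>r\<in>{s<..<t}. x t - x s = v r * (t - s)"
    by (intro mvt_simple) auto
  then obtain r where r: "r \<in> {s<..<t}" "x t - x s = v r * (t - s)"
    by blast
  have "speed_min V \<le> v r"
    using is_motionD(3)[OF m, of r] r st by (auto simp: is_state_def speeds_def)
  then have "speed_min V * (t - s) \<le> v r * (t - s)"
    using st by (intro mult_right_mono) auto
  then show ?thesis using r(2) unfolding x_def by linarith
qed simp

lemma position_mono:
  assumes "is_vehicle V" "u \<in> signal_set V" "is_state V a b" "0 \<le> s" "s \<le> t"
  shows "position V s u a b \<le> position V t u a b"
proof -
  have "0 \<le> speed_min V * (t - s)" using is_vehicleD(1)[OF assms(1)] assms(5) by simp
  then show ?thesis using position_advances[OF assms] by linarith
qed

lemma position_strict_mono: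
  assumes "is_vehicle V" "u \<in> signal_set V" "is_state V a b" "0 \<le> s" "s < t"
  shows "position V s u a b < position V t u a b"
proof -
  have "0 < speed_min V * (t - s)" using is_vehicleD(1)[OF assms(1)] assms(5) by simp
  then show ?thesis using position_advances[OF assms(1-4), of t] assms(5) by linarith
qed

definition crossing_time :: "vehicle \<Rightarrow> (real \<Rightarrow> real) \<Rightarrow> real \<Rightarrow> real \<Rightarrow> real \<Rightarrow> real" where
  "crossing_time V u a b c = (THE t. 0 \<le> t \<and> position V t u a b = c)"

lemma ex1_crossing_time:
  assumes V: "is_vehicle V" and u: "u \<in> signal_set V" and ab: "is_state V a b" and "a \<le> c"
  shows "\<exists>!t. 0 \<le> t \<and> position V t u a b = c"
proof (rule ex_ex1I)
  \<comment> \<open>By this time even a vehicle at minimal speed has covered the distance to \<open>c\<close>.\<close>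
  define t where "t = (c - a) / speed_min V"
  have pos: "0 < speed_min V" using is_vehicleD(1)[OF V] .
  have t: "0 \<le> t" "speed_min V * t = c - a" using pos \<open>a \<le> c\<close> by (auto simp: t_def)
  have "c \<le> position V t u a b"
    using position_advances[OF V u ab, of 0 t] position_0[OF V u ab] t by simp
  moreover have "position V 0 u a b \<le> c" using position_0[OF V u ab] \<open>a \<le> c\<close> by simp
  moreover have "continuous_on {0..t} (\<lambda>t. position V t u a b)"
    by (rule continuous_on_subset[OF continuous_on_position[OF V u ab]]) auto
  ultimately show "\<exists>t. 0 \<le> t \<and> position V t u a b = c"
    using IVT'[of "\<lambda>t. position V t u a b" 0 c t] t by auto
next
  fix s t
  assume "0 \<le> s \<and> position V s u a b = c" "0 \<le> t \<and> position V t u a b = c"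
  then show "s = t"
    using position_strict_mono[OF V u ab, of s t] position_strict_mono[OF V u ab, of t s] by linarith
qed

lemma crossing_time:
  assumes "is_vehicle V" "u \<in> signal_set V" "is_state V a b" "a \<le> c"
  shows "0 \<le> crossing_time V u a b c" "position V (crossing_time V u a b c) u a b = c"
  using theI'[OF ex1_crossing_time[OF assms]] by (auto simp: crossing_time_def)

lemma crossing_time_eqI:
  assumes "is_vehicle V" "u \<in> signal_set V" "is_state V a b" "a \<le> c"
    and "0 \<le> t" "position V t u a b = c"
  shows "crossing_time V u a b c = t"
  using the1_equality[OF ex1_crossing_time[OF assms(1-4)]] assms(5,6)
  by (auto simp: crossing_time_def)

lemma crossing_time_le_iff:
  assumes "is_vehicle V" "u \<in> signal_set V" "is_state V a b" "a \<le> c" "0 \<le> t"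
  shows "crossing_time V u a b c \<le> t \<longleftrightarrow> c \<le> position V t u a b"
  using position_mono[OF assms(1-3) crossing_time(1)[OF assms(1-4)], of t]
    position_strict_mono[OF assms(1-3,5), of "crossing_time V u a b c"]
    crossing_time(2)[OF assms(1-4)] by linarith

lemma reachable_at_iff_crossing_time:
  assumes "is_vehicle V" "is_state V a b" "a \<le> c"
  shows "reachable_at V a b c t \<longleftrightarrow> (\<exists>u\<in>signal_set V. t = crossing_time V u a b c)"
  using crossing_time[OF assms(1) _ assms(2,3)] crossing_time_eqI[OF assms(1) _ assms(2,3)]
  unfolding reachable_at_def by metis

lemma position_le_max_input:
  assumes V: "is_vehicle V" and u: "u \<in> signal_set V"
    and "is_state V a b" "is_state V a b'" "b \<le> b'" "0 \<le> t"
  shows "position V t u a b \<le> position V t (max_input_signal V) a b'"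
  using is_vehicleD(7)[OF V] max_input_signal_in_signal_set[OF V] signal_le_max_input[OF V u] assms
  unfolding monotone_vehicle_def is_state_def by blast

text \<open>
  At the time at which the slower vehicle is at \<open>c\<close>, the faster one is at \<open>c\<close> or beyond, so it
  has already crossed \<open>c\<close>. In particular (for \<open>b = b'\<close>) the minimal time to reach a position is
  attained by the maximal input.
\<close>

lemma crossing_time_max_input_le:
  assumes V: "is_vehicle V" and u: "u \<in> signal_set V"
    and ab: "is_state V a b" and ab': "is_state V a b'" and "b \<le> b'" and c: "a \<le> c"
  shows "crossing_time V (max_input_signal V) a b' c \<le> crossing_time V u a b c"
proof -
  note t = crossing_time[OF V u ab c]
  have "c \<le> position V (crossing_time V u a b c) (max_input_signal V) a b'"
    using position_le_max_input[OF V u ab ab' \<open>b \<le> b'\<close> t(1)] t(2) by simp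
  then show ?thesis
    using crossing_time_le_iff[OF V max_input_signal_in_signal_set[OF V] ab' c t(1)] by simp
qed

lemma earliest_le:
  "u \<in> W \<Longrightarrow> 0 \<le> t \<Longrightarrow> position V t u a b = c \<Longrightarrow> earliest V W a b c \<le> ereal t"
  unfolding earliest_def by (rule Inf_lower) blast

lemma le_latest:
  "u \<in> W \<Longrightarrow> 0 \<le> t \<Longrightarrow> position V t u a b = c \<Longrightarrow> ereal t \<le> latest V W a b c"
  unfolding latest_def by (rule Sup_upper) blast

lemma earliest_eq_max_input:
  assumes V: "is_vehicle V" and ab: "is_state V a b" and c: "a \<le> c"
  shows "earliest V (signal_set V) a b c = ereal (crossing_time V (max_input_signal V) a b c)"
proof (rule antisym)
  note m = max_input_signal_in_signal_set[OF V]
  show "earliest V (signal_set V) a b c \<le> ereal (crossing_time V (max_input_signal V) a b c)"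
    using crossing_time[OF V m ab c] by (intro earliest_le[OF m])
  show "ereal (crossing_time V (max_input_signal V) a b c) \<le> earliest V (signal_set V) a b c"
    unfolding earliest_def
  proof (rule Inf_greatest, clarify)
    fix t u
    assume u: "u \<in> signal_set V" and t: "0 \<le> t" "c = position V t u a b"
    have "crossing_time V u a b c = t"
      using crossing_time_eqI[OF V u ab c t(1)] t(2) by simp
    then show "ereal (crossing_time V (max_input_signal V) a b (position V t u a b)) \<le> ereal t"
      using crossing_time_max_input_le[OF V u ab ab _ c] t by simp
  qed
qed

text \<open>
  At a time between the earliest crossing time and a reachable one, the maximal input has taken the
  vehicle to \<open>c\<close> or beyond, while the signal that reaches \<open>c\<close> at \<open>t'\<close> has not taken it past
  \<open>c\<close>. The position at a fixed time is a continuous function on the connected space of signals, so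
  some signal takes the vehicle exactly to \<open>c\<close>.
\<close>

lemma reachable_times_interval:
  assumes V: "is_vehicle V" and ab: "is_state V a b" and c: "a \<le> c"
    and r: "earliest V (signal_set V) a b c \<le> ereal t" "t \<le> t'" "reachable_at V a b c t'"
  shows "reachable_at V a b c t"
proof -
  note m = max_input_signal_in_signal_set[OF V]
  define X where "X = (\<lambda>u. position V t u a b) ` signal_set V"
  have t: "crossing_time V (max_input_signal V) a b c \<le> t"
    using r(1) earliest_eq_max_input[OF V ab c] by simp
  have t0: "0 \<le> t" using crossing_time(1)[OF V m ab c] t by linarith
  obtain u where u: "u \<in> signal_set V" "position V t' u a b = c"
    using r(3) by (auto simp: reachable_at_def)
  have "position V t u a b \<le> c" using position_mono[OF V u(1) ab t0 r(2)] u(2) by simp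
  moreover have "c \<le> position V t (max_input_signal V) a b"
    using crossing_time_le_iff[OF V m ab c t0] t by simp
  moreover have "connected X"
  proof -
    have "continuous_map (signals V) euclideanreal (\<lambda>u. position V t u a b)"
      using is_vehicleD(5)[OF V] ab t0 by (auto simp: continuous_in_signal_def is_state_def)
    moreover have "connectedin (signals V) (signal_set V)"
      using path_connected_imp_connected_space[OF is_vehicleD(6)[OF V]]
      by (simp add: signal_set_def connectedin_topspace)
    ultimately have "connectedin euclideanreal X"
      unfolding X_def by (rule connectedin_continuous_map_image)
    then show ?thesis by simp
  qed
  ultimately have "c \<in> X"
    using m u(1) unfolding X_def connected_iff_interval by blast
  then show ?thesis using t0 by (auto simp: X_def reachable_at_def)
qed

subsection \<open>Switching the input signal\<close>

lemma integral_concatenation: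
  fixes g h :: "real \<Rightarrow> real"
  assumes T: "0 \<le> T" "T \<le> t"
    and g: "g absolutely_integrable_on {0..T}" and h: "h absolutely_integrable_on {0..t - T}"
  shows "(\<lambda>s. if s < T then g s else h (s - T)) absolutely_integrable_on {0..t}"
    and "integral {0..t} (\<lambda>s. if s < T then g s else h (s - T)) =
      integral {0..T} g + integral {0..t - T} h"
proof -
  let ?f = "\<lambda>s. if s < T then g s else h (s - T)"
  have f1: "?f absolutely_integrable_on {0..T}"
    by (rule absolutely_integrable_spike[OF g, of "{T}"]) auto
  have i1: "integral {0..T} ?f = integral {0..T} g"
    by (rule integral_spike[of "{T}"]) auto
  have hs: "((\<lambda>s. k (s - T)) has_integral I) {T..t} \<longleftrightarrow> (k has_integral I) {0..t - T}"
    for k :: "real \<Rightarrow> real" and I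
    using has_integral_shift_Icc_real[of "\<lambda>s. k (s - T)" T I 0 "t - T"] by (simp add: o_def)
  obtain I J where I: "(h has_integral I) {0..t - T}"
    and J: "((\<lambda>s. norm (h s)) has_integral J) {0..t - T}"
    using h unfolding absolutely_integrable_on_def integrable_on_def by blast
  note I' = iffD2[OF hs I] and J' = iffD2[OF hs J]
  have h': "(\<lambda>s. h (s - T)) absolutely_integrable_on {T..t}"
    using has_integral_integrable[OF I'] has_integral_integrable[OF J']
    by (simp only: absolutely_integrable_on_def)
  have i2: "integral {T..t} (\<lambda>s. h (s - T)) = integral {0..t - T} h"
    using integral_unique[OF I] integral_unique[OF I'] by simp
  have f2: "?f absolutely_integrable_on {T..t}"
    by (rule absolutely_integrable_spike[OF h', of "{}"]) auto
  show f: "?f absolutely_integrable_on {0..t}"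
    by (rule absolutely_integrable_on_combine[OF f1 f2]) (use T in auto)
  have "integral {0..T} ?f + integral {T..t} ?f = integral {0..t} ?f"
    by (rule Henstock_Kurzweil_Integration.integral_combine)
      (use T f in \<open>auto simp: absolutely_integrable_on_def\<close>)
  moreover have "integral {T..t} ?f = integral {T..t} (\<lambda>s. h (s - T))"
    by (rule Henstock_Kurzweil_Integration.integral_cong) auto
  ultimately show "integral {0..t} ?f = integral {0..T} g + integral {0..t - T} h"
    using i1 i2 by simp
qed

text \<open>
  Two motions that fit together in position and speed concatenate to a motion under the switched
  signal. Well-posedness speaks only of motions on the whole time axis; through this lemma it also
  yields that the past of a trajectory does not depend on later inputs and that its future depends
  only on the current state.
\<close>

lemma is_motion_switch_signal:
  assumes xv: "is_motion V u a b x v" and yw: "is_motion V w (x T) (v T) y z" and T: "0 \<le> T"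
  shows "is_motion V (switch_signal T u w) a b
    (\<lambda>t. if t \<le> T then x t else y (t - T)) (\<lambda>t. if t \<le> T then v t else z (t - T))"
    (is "is_motion V ?s a b ?x ?v")
proof -
  let ?g = "\<lambda>s. dynamics V (x s) (v s) (u s)" and ?h = "\<lambda>s. dynamics V (y s) (z s) (w s)"
  let ?f = "\<lambda>s. dynamics V (?x s) (?v s) (?s s)"
  have y0: "y 0 = x T" "z 0 = v T" using is_motionD(1,2)[OF yw] .
  \<comment> \<open>At time \<open>T\<close> itself the signal is already \<open>w\<close>, and the state \<open>x T\<close>, \<open>v T\<close> is the initial state of \<open>y\<close>.\<close>
  have f: "?f = (\<lambda>s. if s < T then ?g s else ?h (s - T))"
    using y0 by (auto simp: fun_eq_iff switch_signal_def)
  have g: "?g absolutely_integrable_on {0..t}" "v t = b + integral {0..t} ?g" if "0 \<le> t" for t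
    using is_motionD(5,6)[OF xv that] .
  have h: "?h absolutely_integrable_on {0..t}" "z t = v T + integral {0..t} ?h" if "0 \<le> t" for t
    using is_motionD(5,6)[OF yw that] .
  show ?thesis
    unfolding is_motion_def
  proof (intro conjI allI impI)
    show "?x 0 = a" "?v 0 = b" using is_motionD(1,2)[OF xv] T by auto
  next
    fix t :: real
    assume t: "0 \<le> t"
    show "?x t \<in> positions V" "?v t \<in> speeds V"
      using is_motionD(3)[OF xv t] is_motionD(3)[OF yw, of "t - T"] by (auto simp: is_state_def)
    \<comment> \<open>At the switching time both pieces of the motion have the same derivative.\<close>
    have cl: "closure {0..T} \<inter> closure {T<..} = {T}" using T by auto
    have "((\<lambda>t. if t \<in> {0..T} then x t else y (t - T)) has_vector_derivative
        (if t \<in> {0..T} then v t else z (t - T))) (at t within {0..})"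
    proof (rule has_vector_derivative_If_within_closures[where T = "{T<..}"])
      show "t \<in> {0..T} \<union> {T<..}" "{0..} = {0..T} \<union> {T<..}" using t T by auto
      show "(x has_vector_derivative v t)
          (at t within {0..T} \<union> closure {0..T} \<inter> closure {T<..})"
        using is_motionD(4)[OF xv t] T unfolding cl has_real_derivative_iff_has_vector_derivative
        by (auto intro: has_vector_derivative_within_subset[where S = "{0..}"])
      assume "t \<in> {T<..} \<union> closure {0..T} \<inter> closure {T<..}"
      then have "T \<le> t" unfolding cl by auto
      then have "(y has_vector_derivative z (t - T)) (at (t - T) within {0..})"
        using is_motionD(4)[OF yw] by (simp add: has_real_derivative_iff_has_vector_derivative)
      moreover have "(\<lambda>t. t - T) ` {T..} \<subseteq> {0..}" by auto
      ultimately have "(y has_vector_derivative z (t - T)) (at (t - T) within (\<lambda>t. t - T) ` {T..})"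
        by (rule has_vector_derivative_within_subset)
      moreover have "((\<lambda>t. t - T) has_vector_derivative 1) (at t within {T..})"
        unfolding has_real_derivative_iff_has_vector_derivative[symmetric]
        by (auto intro!: derivative_eq_intros)
      ultimately have "((y \<circ> (\<lambda>t. t - T)) has_vector_derivative 1 *\<^sub>R z (t - T)) (at t within {T..})"
        by (rule vector_diff_chain_within[rotated])
      then show "((\<lambda>t. y (t - T)) has_vector_derivative z (t - T))
          (at t within {T<..} \<union> closure {0..T} \<inter> closure {T<..})"
        unfolding cl o_def
        by (auto intro: has_vector_derivative_within_subset[where S = "{T..}"])
    qed (use y0 T in auto)
    then show "(?x has_real_derivative ?v t) (at t within {0..})"
      using t unfolding has_real_derivative_iff_has_vector_derivative
      by (auto elim!: has_vector_derivative_transform[rotated -1])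
    show "?f absolutely_integrable_on {0..t}"
    proof (cases "T \<le> t")
      case True
      then show ?thesis
        unfolding f by (intro integral_concatenation g h) (use T in auto)
    next
      case False
      then show ?thesis
        unfolding f by (intro absolutely_integrable_spike[OF g(1)[OF t], of "{}"]) auto
    qed
    show "?v t = b + integral {0..t} ?f"
    proof (cases "T < t")
      case True
      then have "integral {0..t} ?f = integral {0..T} ?g + integral {0..t - T} ?h"
        unfolding f by (intro integral_concatenation g h) (use T in auto)
      then show ?thesis using True g(2)[OF T] h(2)[of "t - T"] by simp
    next
      case False
      then have "integral {0..t} ?f = integral {0..t} ?g"
        unfolding f by (intro integral_spike[of "{T}"]) auto
      then show ?thesis using False g(2)[OF t] by simp
    qed
  qed
qed

lemma position_switch_signal:
  assumes V: "is_vehicle V" and u: "u \<in> signal_set V" and w: "w \<in> signal_set V"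
    and ab: "is_state V a b" and T: "0 \<le> T" and t: "0 \<le> t"
  shows "position V (T + t) (switch_signal T u w) a b =
    position V t w (position V T u a b) (speed V T u a b)"
proof -
  have st: "is_state V (position V T u a b) (speed V T u a b)"
    using state_position[OF V u ab T] .
  have "is_motion V (switch_signal T u w) a b
    (\<lambda>t. if t \<le> T then position V t u a b
      else position V (t - T) w (position V T u a b) (speed V T u a b))
    (\<lambda>t. if t \<le> T then speed V t u a b
      else speed V (t - T) w (position V T u a b) (speed V T u a b))"
    by (rule is_motion_switch_signal[OF is_motion_position[OF V u ab] is_motion_position[OF V w st] T])
  from motion_unique[OF V switch_signal_in_signal_set[OF V u w T] ab this, of "T + t"]
  show ?thesis using t T position_0[OF V w st] by (auto split: if_splits)
qed

lemma crossing_time_switch_signal: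
  assumes V: "is_vehicle V" and u: "u \<in> signal_set V" and w: "w \<in> signal_set V"
    and ab: "is_state V a b" and T: "0 \<le> T" and c: "position V T u a b \<le> c"
  shows "crossing_time V (switch_signal T u w) a b c =
    T + crossing_time V w (position V T u a b) (speed V T u a b) c"
proof (rule crossing_time_eqI)
  note st = state_position[OF V u ab T]
  note ct = crossing_time[OF V w st c]
  show "is_vehicle V" "switch_signal T u w \<in> signal_set V" "is_state V a b"
    using V ab switch_signal_in_signal_set[OF V u w T] by auto
  show "a \<le> c"
    using position_mono[OF V u ab _ T] position_0[OF V u ab] c by simp
  show "0 \<le> T + crossing_time V w (position V T u a b) (speed V T u a b) c"
    using ct T by simp
  show "position V (T + crossing_time V w (position V T u a b) (speed V T u a b) c)
      (switch_signal T u w) a b = c"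
    using position_switch_signal[OF V u w ab T ct(1)] ct(2) by simp
qed

text \<open>
  The vehicle passes \<open>d\<close> at some unknown admissible speed and then accelerates as much as it can.
  The two bounds compare this speed with the extreme ones.
\<close>

lemma crossing_time_continue_at_max_input:
  assumes V: "is_vehicle V" and u: "u \<in> signal_set V" and ab: "is_state V a b" and d: "a \<le> d"
    and c: "d \<le> c"
  defines "t \<equiv> crossing_time V u a b d"
  shows "t + crossing_time V (max_input_signal V) d (speed_max V) c
      \<le> crossing_time V (switch_signal t u (max_input_signal V)) a b c"
    and "crossing_time V (switch_signal t u (max_input_signal V)) a b c
      \<le> t + crossing_time V (max_input_signal V) d (speed_min V) c"
proof -
  note m = max_input_signal_in_signal_set[OF V]
  have t: "0 \<le> t" "position V t u a b = d" using crossing_time[OF V u ab d] by (auto simp: t_def)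
  define v where "v = speed V t u a b"
  have st: "is_state V d v" using state_position[OF V u ab t(1)] t(2) by (simp add: v_def)
  then have v: "speed_min V \<le> v" "v \<le> speed_max V" by (auto simp: is_state_def speeds_def)
  have ext: "is_state V d (speed_min V)" "is_state V d (speed_max V)"
    using st extreme_speeds[OF V] by (auto simp: is_state_def)
  have eq: "crossing_time V (switch_signal t u (max_input_signal V)) a b c =
      t + crossing_time V (max_input_signal V) d v c"
    using crossing_time_switch_signal[OF V u m ab t(1)] t(2) c by (simp add: v_def)
  show "t + crossing_time V (max_input_signal V) d (speed_max V) c
      \<le> crossing_time V (switch_signal t u (max_input_signal V)) a b c"
    using crossing_time_max_input_le[OF V m st ext(2) v(2) c] eq by simp
  show "crossing_time V (switch_signal t u (max_input_signal V)) a b c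
      \<le> t + crossing_time V (max_input_signal V) d (speed_min V) c"
    using crossing_time_max_input_le[OF V m ext(1) st v(1) c] eq by simp
qed

section \<open>The operations of a vehicle\<close>

locale intersection_scenario =
  fixes S :: intersection and x0 v0 :: "nat \<Rightarrow> real"
  assumes intersection: "is_intersection S"
    and initial: "initial_condition S x0 v0"
begin

lemma op_vehicle:
  assumes "(i, j) \<in> all_ops S"
  shows "is_vehicle (veh S j)" "is_state (veh S j) (x0 j) (v0 j)" "\<alpha> S i j < \<beta> S i j"
  using assms intersection initial
  by (auto simp: is_intersection_def initial_condition_def is_state_def)

lemma ops_all_ops: "(i, j) \<in> ops S x0 \<Longrightarrow> (i, j) \<in> all_ops S"
  and ops_before_exit: "(i, j) \<in> ops S x0 \<Longrightarrow> x0 j < \<beta> S i j"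
  and first_ops_ops: "(i, j) \<in> first_ops S x0 \<Longrightarrow> (i, j) \<in> ops S x0"
  by (auto simp: ops_def first_ops_def)

lemma finite_all_ops: "finite (all_ops S)"
proof (rule finite_subset)
  show "all_ops S \<subseteq> {1..num_areas S} \<times> {1..num_vehicles S}"
    using intersection by (simp add: is_intersection_def)
qed simp

lemma finite_ops: "finite (ops S x0)"
  by (rule finite_subset[OF _ finite_all_ops]) (auto simp: ops_def)

lemma finite_first_ops: "finite (first_ops S x0)"
  by (rule finite_subset[OF _ finite_ops]) (auto simp: first_ops_def)

lemma finite_disj_arcs: "finite (disj_arcs S x0)"
proof (rule finite_subset)
  show "disj_arcs S x0 \<subseteq> (\<lambda>((i, j), (i', j')). (i, j, j')) ` (ops S x0 \<times> ops S x0)"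
    by (force simp: disj_arcs_def)
qed (simp add: finite_ops)

text \<open>
  The conflict areas on a path are disjoint and have positive length, so their order is determined by
  their entries alone. This makes the first operation unique and puts every other operation ahead of
  the initial position.
\<close>

lemma areas_of_vehicle_ordered:
  assumes "(i, j) \<in> all_ops S" "(i', j) \<in> all_ops S" "i \<noteq> i'" "\<alpha> S i j \<le> \<alpha> S i' j"
  shows "\<beta> S i j \<le> \<alpha> S i' j"
proof -
  have "\<beta> S i j \<le> \<alpha> S i' j \<or> \<beta> S i' j \<le> \<alpha> S i j"
    using intersection assms unfolding is_intersection_def by blast
  then show ?thesis using op_vehicle(3)[OF assms(2)] assms(4) by linarith
qed

lemma first_op_unique:
  assumes "(i, j) \<in> first_ops S x0" "(i', j) \<in> first_ops S x0"
  shows "i = i'"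
proof (rule ccontr)
  assume "i \<noteq> i'"
  moreover have m: "(i, j) \<in> all_ops S" "(i', j) \<in> all_ops S" "\<alpha> S i j = \<alpha> S i' j"
    using assms by (force simp: first_ops_def ops_def)+
  ultimately show False
    using areas_of_vehicle_ordered[of i j i'] op_vehicle(3)[of i j] by auto
qed

lemma first_area_eq: "(i, j) \<in> first_ops S x0 \<Longrightarrow> first_area S x0 j = i"
  unfolding first_area_def using first_op_unique by blast

lemma first_area_first_op:
  assumes "(i, j) \<in> ops S x0"
  shows "(first_area S x0 j, j) \<in> first_ops S x0"
proof -
  let ?A = "{i. (i, j) \<in> ops S x0}"
  have "?A \<subseteq> fst ` ops S x0" by force
  then have fin: "finite ?A" using finite_ops by (meson finite_imageI finite_subset)
  have "?A \<noteq> {}" using assms by auto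
  then obtain l where "l \<in> ?A" "\<And>i. i \<in> ?A \<Longrightarrow> \<alpha> S l j \<le> \<alpha> S i j"
    using arg_min_if_finite(1)[OF fin, of "\<lambda>i. \<alpha> S i j"] arg_min_least[OF fin, of _ "\<lambda>i. \<alpha> S i j"]
    by blast
  then have "(l, j) \<in> first_ops S x0" by (auto simp: first_ops_def)
  then show ?thesis using first_area_eq by blast
qed

lemma before_entry_of_later_op:
  assumes "(i, j) \<in> ops S x0" "(i, j) \<notin> first_ops S x0"
  shows "x0 j < \<alpha> S i j"
proof -
  note f = first_area_first_op[OF assms(1)]
  have "\<alpha> S (first_area S x0 j) j \<le> \<alpha> S i j" using f assms(1) by (auto simp: first_ops_def)
  moreover have "first_area S x0 j \<noteq> i" using f assms(2) by auto
  ultimately have "\<beta> S (first_area S x0 j) j \<le> \<alpha> S i j"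
    using areas_of_vehicle_ordered ops_all_ops first_ops_ops f assms(1) by blast
  then show ?thesis using ops_before_exit[OF first_ops_ops[OF f]] by linarith
qed

lemma finite_entries: "finite {\<alpha> S i j | i. (i, j) \<in> all_ops S}"
proof (rule finite_subset)
  show "{\<alpha> S i j | i. (i, j) \<in> all_ops S} \<subseteq> (\<lambda>(i, j). \<alpha> S i j) ` all_ops S" by force
qed (simp add: finite_all_ops)

lemma \<alpha>_min_le:
  assumes "(i, j) \<in> all_ops S"
  shows "\<alpha>_min S j \<le> \<alpha> S i j"
  unfolding \<alpha>_min_def using assms finite_entries by (intro Min_le) auto

lemma \<alpha>_min_attained:
  assumes "(i, j) \<in> all_ops S"
  obtains l where "(l, j) \<in> all_ops S" "\<alpha>_min S j = \<alpha> S l j"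
proof -
  have "\<alpha>_min S j \<in> {\<alpha> S i j | i. (i, j) \<in> all_ops S}"
    unfolding \<alpha>_min_def using assms finite_entries by (intro Min_in) auto
  then show thesis using that by blast
qed

text \<open>
  A vehicle that starts before \<open>\<alpha>_min\<close> has all its operations still ahead of it.
\<close>

lemma first_entry_eq_\<alpha>_min:
  assumes f: "(i, j) \<in> first_ops S x0" and x: "x0 j < \<alpha>_min S j"
  shows "\<alpha> S i j = \<alpha>_min S j"
proof -
  have a: "(i, j) \<in> all_ops S" using f ops_all_ops first_ops_ops by blast
  obtain l where l: "(l, j) \<in> all_ops S" "\<alpha>_min S j = \<alpha> S l j" using \<alpha>_min_attained[OF a] .
  then have "(l, j) \<in> ops S x0" using x op_vehicle(3)[OF l(1)] by (simp add: ops_def)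
  then have "\<alpha> S i j \<le> \<alpha>_min S j" using f l(2) by (auto simp: first_ops_def)
  then show ?thesis using \<alpha>_min_le[OF a] by simp
qed

lemma state_at_\<alpha>_min:
  assumes i: "(i, j) \<in> all_ops S" and x: "x0 j < \<alpha>_min S j" and b: "b \<in> speeds (veh S j)"
  shows "is_state (veh S j) (\<alpha>_min S j) b"
proof -
  note V = op_vehicle(1,2)[OF i]
  note m = max_input_signal_in_signal_set[OF V(1)]
  note t = crossing_time[OF V(1) m V(2) less_imp_le[OF x]]
  show ?thesis using state_position[OF V(1) m V(2) t(1)] t(2) b by (simp add: is_state_def)
qed

section \<open>The upper bound problem as a system of difference constraints\<close>

abbreviation "full_throttle j a b c \<equiv>
  crossing_time (veh S j) (max_input_signal (veh S j)) a b c"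

text \<open>
  The value \<open>0\<close> for a vehicle that starts inside its first area is the release time and deadline
  of that entry in both problems.
\<close>

definition entry_time :: "(real \<Rightarrow> real) \<Rightarrow> nat \<Rightarrow> nat \<Rightarrow> real" where
  "entry_time u i j =
     (if x0 j < \<alpha> S i j then crossing_time (veh S j) u (x0 j) (v0 j) (\<alpha> S i j) else 0)"

definition exit_time :: "(real \<Rightarrow> real) \<Rightarrow> nat \<Rightarrow> nat \<Rightarrow> real" where
  "exit_time u i j = crossing_time (veh S j) u (x0 j) (v0 j) (\<beta> S i j)"

definition first_entry :: "(nat \<Rightarrow> nat \<Rightarrow> real) \<Rightarrow> nat \<Rightarrow> real" where
  "first_entry TF j = TF (first_area S x0 j) j"

definition earliest_first_entry :: "nat \<Rightarrow> real" where
  "earliest_first_entry j = entry_time (max_input_signal (veh S j)) (first_area S x0 j) j"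

text \<open>
  \<open>T_bar\<close> and \<open>P_bar\<close> depend on the schedule only through the time of the first entry of the
  vehicle, by addition of these two real constants.
\<close>

definition entry_delay :: "nat \<Rightarrow> nat \<Rightarrow> real" where
  "entry_delay i j =
     (if (i, j) \<in> first_ops S x0 then 0
      else if x0 j < \<alpha>_min S j then full_throttle j (\<alpha>_min S j) (speed_max (veh S j)) (\<alpha> S i j)
      else full_throttle j (x0 j) (v0 j) (\<alpha> S i j) - earliest_first_entry j)"

definition exit_delay :: "nat \<Rightarrow> nat \<Rightarrow> real" where
  "exit_delay i j =
     (if x0 j < \<alpha>_min S j then full_throttle j (\<alpha>_min S j) (speed_min (veh S j)) (\<beta> S i j)
      else full_throttle j (x0 j) (v0 j) (\<beta> S i j) - earliest_first_entry j)"

lemma R_bar_eq: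
  assumes f: "(i, j) \<in> first_ops S x0"
  shows "R_bar S x0 v0 i j = ereal (earliest_first_entry j)"
proof -
  have i: "(i, j) \<in> all_ops S" using f first_ops_ops ops_all_ops by blast
  note V = op_vehicle(1,2)[OF i]
  show ?thesis
    using earliest_eq_max_input[OF V, of "\<alpha> S i j"] first_entry_eq_\<alpha>_min[OF f] first_area_eq[OF f]
    by (auto simp: R_bar_def earliest_first_entry_def entry_time_def \<tau>_def)
qed

lemma D_bar_eq_R_bar:
  "\<not> x0 j < \<alpha>_min S j \<Longrightarrow> D_bar S x0 v0 i j = R_bar S x0 v0 i j"
  by (simp add: D_bar_def R_bar_def)

lemma T_bar_eq:
  assumes i: "(i, j) \<in> ops S x0"
  shows "T_bar S x0 v0 TF i j = ereal (first_entry TF j + entry_delay i j)"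
proof (cases "(i, j) \<in> first_ops S x0")
  case True
  then show ?thesis
    using first_area_eq[OF True] by (simp add: T_bar_def entry_delay_def first_entry_def)
next
  case False
  note a = ops_all_ops[OF i]
  note V = op_vehicle(1,2)[OF a]
  note f = first_area_first_op[OF i]
  have "\<tau> (veh S j) (x0 j) (v0 j) (\<alpha> S i j) = ereal (full_throttle j (x0 j) (v0 j) (\<alpha> S i j))"
    unfolding \<tau>_def using before_entry_of_later_op[OF i False]
    by (intro earliest_eq_max_input V) auto
  moreover have "\<tau> (veh S j) (\<alpha>_min S j) (speed_max (veh S j)) (\<alpha> S i j) =
      ereal (full_throttle j (\<alpha>_min S j) (speed_max (veh S j)) (\<alpha> S i j))" if "x0 j < \<alpha>_min S j"
    unfolding \<tau>_def
    by (intro earliest_eq_max_input V(1) state_at_\<alpha>_min[OF a that] extreme_speeds \<alpha>_min_le[OF a])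
  ultimately show ?thesis
    using False R_bar_eq[OF f]
    by (simp add: T_bar_def entry_delay_def first_entry_def Let_def)
qed

lemma P_bar_eq:
  assumes i: "(i, j) \<in> ops S x0"
  shows "P_bar S x0 v0 TF i j = ereal (first_entry TF j + exit_delay i j)"
proof -
  note a = ops_all_ops[OF i]
  note V = op_vehicle(1,2)[OF a]
  note f = first_area_first_op[OF i]
  have fa: "i = first_area S x0 j" if "(i, j) \<in> first_ops S x0"
    using first_area_eq[OF that] by simp
  have "\<tau> (veh S j) (x0 j) (v0 j) (\<beta> S i j) = ereal (full_throttle j (x0 j) (v0 j) (\<beta> S i j))"
    unfolding \<tau>_def using ops_before_exit[OF i]
    by (intro earliest_eq_max_input V) auto
  moreover have "\<tau> (veh S j) (\<alpha>_min S j) (speed_min (veh S j)) (\<beta> S i j) =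
      ereal (full_throttle j (\<alpha>_min S j) (speed_min (veh S j)) (\<beta> S i j))" if "x0 j < \<alpha>_min S j"
    unfolding \<tau>_def using \<alpha>_min_le[OF a] op_vehicle(3)[OF a]
    by (intro earliest_eq_max_input V(1) state_at_\<alpha>_min[OF a that] extreme_speeds) auto
  ultimately show ?thesis
    using R_bar_eq[OF f] first_entry_eq_\<alpha>_min[OF f] fa
    by (auto simp: P_bar_def exit_delay_def first_entry_def)
qed

lemma disj_arcs_sym: "(i, j, j') \<in> disj_arcs S x0 \<Longrightarrow> (i, j', j) \<in> disj_arcs S x0"
  by (auto simp: disj_arcs_def)

text \<open>
  All times involved are finite, so feasibility is a system of difference constraints in the real
  variables \<open>first_entry TF j\<close>. As each disjunctive arc is listed in both directions, one of the two
  inequalities per arc is enough.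
\<close>

lemma upper_feasible_iff:
  "upper_feasible S M x0 v0 TF k \<longleftrightarrow>
    is_first_schedule S x0 v0 TF \<and> is_order S x0 k \<and>
    (\<forall>(i, j)\<in>first_ops S x0. earliest_first_entry j \<le> TF i j) \<and>
    (\<forall>(i, j, j')\<in>disj_arcs S x0. first_entry TF j + exit_delay i j
       \<le> first_entry TF j' + entry_delay i j' + M * (1 - real (k i j j')))"
proof -
  have "(\<forall>(i, j)\<in>first_ops S x0. R_bar S x0 v0 i j \<le> ereal (TF i j)) \<longleftrightarrow>
      (\<forall>(i, j)\<in>first_ops S x0. earliest_first_entry j \<le> TF i j)"
    by (auto simp: R_bar_eq)
  moreover have "P_bar S x0 v0 TF i j \<le> T_bar S x0 v0 TF i j' + ereal (M * (1 - real (k i j j')))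
      \<longleftrightarrow> first_entry TF j + exit_delay i j
        \<le> first_entry TF j' + entry_delay i j' + M * (1 - real (k i j j'))"
    if "(i, j, j') \<in> disj_arcs S x0" for i j j'
    using that by (simp add: disj_arcs_def P_bar_eq T_bar_eq)
  ultimately show ?thesis
    using disj_arcs_sym unfolding upper_feasible_def by (simp add: Ball_def) metis
qed

text \<open>
  The lower end of the interval of reachable times is attained, so schedules may be moved down as far
  as the release times.
\<close>

lemma first_schedule_interval:
  assumes sched: "is_first_schedule S x0 v0 TF'"
    and le: "\<And>i j. (i, j) \<in> first_ops S x0 \<Longrightarrow> earliest_first_entry j \<le> TF i j \<and> TF i j \<le> TF' i j"
  shows "is_first_schedule S x0 v0 TF"
  unfolding is_first_schedule_def
proof clarify
  fix i j
  assume f: "(i, j) \<in> first_ops S x0"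
  have i: "(i, j) \<in> all_ops S" using f first_ops_ops ops_all_ops by blast
  note V = op_vehicle(1,2)[OF i]
  show "if x0 j < \<alpha> S i j then reachable_at (veh S j) (x0 j) (v0 j) (\<alpha> S i j) (TF i j)
    else TF i j = 0"
  proof (cases "x0 j < \<alpha> S i j")
    case True
    have r: "reachable_at (veh S j) (x0 j) (v0 j) (\<alpha> S i j) (TF' i j)"
      using sched f True by (auto simp: is_first_schedule_def)
    have e: "earliest_first_entry j = full_throttle j (x0 j) (v0 j) (\<alpha> S i j)"
      using True first_area_eq[OF f] by (simp add: earliest_first_entry_def entry_time_def)
    then have "earliest (veh S j) (signal_set (veh S j)) (x0 j) (v0 j) (\<alpha> S i j) \<le> ereal (TF i j)"
      using earliest_eq_max_input[OF V less_imp_le[OF True]] le[OF f] by simp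
    then show ?thesis
      using reachable_times_interval[OF V less_imp_le[OF True] _ _ r] le[OF f] True by simp
  next
    case False
    have "TF' i j = 0" using sched f False by (auto simp: is_first_schedule_def)
    moreover have "earliest_first_entry j = 0"
      using False first_area_eq[OF f] by (simp add: earliest_first_entry_def entry_time_def)
    ultimately show ?thesis using le[OF f] False by simp
  qed
qed

subsection \<open>The optimum is attained\<close>

text \<open>
  Feasibility depends on an order only through the set of disjunctive arcs on which it is \<open>1\<close>, and
  there are finitely many such sets.
\<close>

definition order_of_arcs :: "(nat \<times> nat \<times> nat) set \<Rightarrow> nat \<Rightarrow> nat \<Rightarrow> nat \<Rightarrow> nat" where
  "order_of_arcs K i j j' = (if (i, j, j') \<in> K then 1 else 0)"

lemma upper_feasible_finite_orders:
  assumes "upper_feasible S M x0 v0 TF k"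
  obtains K where "K \<subseteq> disj_arcs S x0" "upper_feasible S M x0 v0 TF (order_of_arcs K)"
proof
  define K where "K = {(i, j, j'). (i, j, j') \<in> disj_arcs S x0 \<and> k i j j' = 1}"
  show "K \<subseteq> disj_arcs S x0" by (auto simp: K_def)
  have order: "is_order S x0 k" using assms by (simp add: upper_feasible_def)
  have eq: "order_of_arcs K i j j' = k i j j'" if "(i, j, j') \<in> disj_arcs S x0" for i j j'
    using order that by (auto simp: is_order_def order_of_arcs_def K_def)
  have "is_order S x0 (order_of_arcs K)"
    using order unfolding is_order_def by (auto simp: eq disj_arcs_sym)
  then show "upper_feasible S M x0 v0 TF (order_of_arcs K)"
    using assms unfolding upper_feasible_def by (auto simp: eq disj_arcs_sym)
qed

lemma upper_objective_le_iff:
  assumes "0 \<le> e"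
  shows "upper_objective S x0 v0 TF \<le> ereal e \<longleftrightarrow>
    (\<forall>(i, j)\<in>first_ops S x0. ereal (TF i j) - D_bar S x0 v0 i j \<le> ereal e)"
  unfolding upper_objective_def
  by (subst Max_le_iff) (use assms finite_first_ops in auto)

text \<open>
  Lowering \<open>first_entry TF j\<close> preserves the constraints that bound it from above. The variable on the
  right-hand side of a constraint is lowered as well, but only to the infimum of values that each
  satisfy the constraint.
\<close>

lemma upper_feasible_pointwise_Inf:
  assumes Q: "Q \<noteq> {}" "\<And>TF. TF \<in> Q \<Longrightarrow> upper_feasible S M x0 v0 TF k"
  defines "TF0 \<equiv> \<lambda>i j. INF TF\<in>Q. TF i j"
  shows "upper_feasible S M x0 v0 TF0 k"
    and "TF \<in> Q \<Longrightarrow> (i, j) \<in> first_ops S x0 \<Longrightarrow> TF0 i j \<le> TF i j"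
proof -
  obtain TF1 where TF1: "TF1 \<in> Q" using Q(1) by blast
  have lb: "earliest_first_entry j \<le> TF i j" if "TF \<in> Q" "(i, j) \<in> first_ops S x0" for TF i j
    using Q(2)[OF that(1)] that(2) unfolding upper_feasible_iff by blast
  have le: "TF0 i j \<le> TF i j" if "TF \<in> Q" "(i, j) \<in> first_ops S x0" for TF i j
    unfolding TF0_def by (rule cINF_lower[OF bdd_belowI2 that(1)]) (use lb that(2) in blast)
  then show "TF \<in> Q \<Longrightarrow> (i, j) \<in> first_ops S x0 \<Longrightarrow> TF0 i j \<le> TF i j" .
  have ge: "c \<le> TF0 i j" if "\<And>TF. TF \<in> Q \<Longrightarrow> c \<le> TF i j" for c i j
    unfolding TF0_def by (rule cINF_greatest[OF Q(1)]) (use that in blast)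
  show "upper_feasible S M x0 v0 TF0 k"
    unfolding upper_feasible_iff
  proof (intro conjI)
    show "is_order S x0 k" using Q(2)[OF TF1] by (simp add: upper_feasible_iff)
    show "\<forall>(i, j)\<in>first_ops S x0. earliest_first_entry j \<le> TF0 i j"
      using lb ge by blast
    have "is_first_schedule S x0 v0 TF1" using Q(2)[OF TF1] by (simp add: upper_feasible_iff)
    then show "is_first_schedule S x0 v0 TF0"
      by (rule first_schedule_interval) (use lb ge le[OF TF1] in blast)
    show "\<forall>(i, j, j')\<in>disj_arcs S x0. first_entry TF0 j + exit_delay i j
       \<le> first_entry TF0 j' + entry_delay i j' + M * (1 - real (k i j j'))"
    proof clarify
      fix i j j'
      assume arc: "(i, j, j') \<in> disj_arcs S x0"
      then have f: "(first_area S x0 j, j) \<in> first_ops S x0"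
        by (auto simp: disj_arcs_def intro: first_area_first_op)
      have "first_entry TF0 j + exit_delay i j - entry_delay i j' - M * (1 - real (k i j j'))
          \<le> first_entry TF j'" if TF: "TF \<in> Q" for TF
      proof -
        have "first_entry TF j + exit_delay i j
            \<le> first_entry TF j' + entry_delay i j' + M * (1 - real (k i j j'))"
          using Q(2)[OF TF] arc by (auto simp: upper_feasible_iff)
        moreover have "first_entry TF0 j \<le> first_entry TF j"
          using le[OF TF f] by (simp add: first_entry_def)
        ultimately show ?thesis by linarith
      qed
      then have "first_entry TF0 j + exit_delay i j - entry_delay i j' - M * (1 - real (k i j j'))
          \<le> first_entry TF0 j'"
        unfolding first_entry_def by (rule ge)
      then show "first_entry TF0 j + exit_delay i j
          \<le> first_entry TF0 j' + entry_delay i j' + M * (1 - real (k i j j'))"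
        by linarith
    qed
  qed
qed

text \<open>
  For every \<open>e > 0\<close> some order has a schedule of objective value at most \<open>e\<close>. As there are
  finitely many orders, a single one serves for arbitrarily small \<open>e\<close>, and then for all. The pointwise
  infimum of its feasible schedules exceeds no deadline by more than any \<open>e > 0\<close>.
\<close>

lemma upper_bound_attained:
  assumes "s_U_star S M x0 v0 = 0"
  obtains TF k where "upper_feasible S M x0 v0 TF k"
    "\<And>i j. (i, j) \<in> first_ops S x0 \<Longrightarrow> ereal (TF i j) \<le> D_bar S x0 v0 i j"
proof -
  define good where "good e K TF \<longleftrightarrow> upper_feasible S M x0 v0 TF (order_of_arcs K) \<and>
    upper_objective S x0 v0 TF \<le> ereal e" for e K TF
  have ex: "\<exists>K\<in>Pow (disj_arcs S x0). \<exists>TF. good e K TF" if "0 < e" for e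
  proof -
    have "s_U_star S M x0 v0 < ereal e" using assms that by simp
    then obtain TF k where "upper_feasible S M x0 v0 TF k" "upper_objective S x0 v0 TF < ereal e"
      unfolding s_U_star_def Inf_less_iff by blast
    then show ?thesis
      using upper_feasible_finite_orders[of M TF k] unfolding good_def by (metis PowI less_imp_le)
  qed
  have "\<forall>\<^sub>F e :: real in at_right 0. 0 < e"
    by (rule eventually_at_right_less)
  then have "\<forall>\<^sub>F e in at_right 0. \<exists>K\<in>Pow (disj_arcs S x0). \<exists>TF. good e K TF"
    by (rule eventually_mono) (rule ex)
  then have "\<exists>\<^sub>F e in at_right 0. \<exists>K\<in>Pow (disj_arcs S x0). \<exists>TF. good e K TF"
    by (rule eventually_frequently[rotated]) simp
  then have "\<exists>K\<in>Pow (disj_arcs S x0). \<exists>\<^sub>F e in at_right 0. \<exists>TF. good e K TF"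
    by (rule frequently_bex_finite[rotated]) (simp add: finite_disj_arcs)
  then obtain K where freq: "\<exists>\<^sub>F e in at_right 0. \<exists>TF. good e K TF"
    by blast
  have good: "\<exists>TF. good e K TF" if "0 < e" for e
  proof -
    have "\<forall>\<^sub>F d in at_right 0. d < e"
      using that by (rule order_tendstoD[OF tendsto_ident_at])
    then have "\<exists>\<^sub>F d in at_right 0. (\<exists>TF. good d K TF) \<and> d < e"
      by (rule frequently_eventually_frequently[OF freq])
    then obtain d TF where TF: "good d K TF" and "d < e" by (blast dest: frequently_ex)
    then have "ereal d \<le> ereal e" by simp
    then have "good e K TF" using TF unfolding good_def by (blast intro: order_trans)
    then show ?thesis by blast
  qed
  define Q where "Q = {TF. upper_feasible S M x0 v0 TF (order_of_arcs K)}"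
  define TF0 where "TF0 = (\<lambda>i j. INF TF\<in>Q. TF i j)"
  have Q: "Q \<noteq> {}" "TF \<in> Q \<Longrightarrow> upper_feasible S M x0 v0 TF (order_of_arcs K)" for TF
    using good[of 1] by (auto simp: Q_def good_def)
  have Inf: "upper_feasible S M x0 v0 TF0 (order_of_arcs K)"
    "TF \<in> Q \<Longrightarrow> (i, j) \<in> first_ops S x0 \<Longrightarrow> TF0 i j \<le> TF i j" for TF i j
    unfolding TF0_def by (rule upper_feasible_pointwise_Inf; use Q in blast)+
  show thesis
  proof (rule that)
    show "upper_feasible S M x0 v0 TF0 (order_of_arcs K)" by (rule Inf(1))
    fix i j
    assume f: "(i, j) \<in> first_ops S x0"
    show "ereal (TF0 i j) \<le> D_bar S x0 v0 i j"
    proof (rule ereal_le_epsilon2)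
      fix e :: real
      assume "0 < e"
      then obtain TF where "TF \<in> Q" and obj: "upper_objective S x0 v0 TF \<le> ereal e"
        using good by (auto simp: good_def Q_def)
      then have "TF0 i j \<le> TF i j" using Inf(2) f by blast
      moreover have "ereal (TF i j) - D_bar S x0 v0 i j \<le> ereal e"
        using obj f \<open>0 < e\<close> by (auto simp: upper_objective_le_iff)
      ultimately show "ereal (TF0 i j) \<le> D_bar S x0 v0 i j + ereal e"
        by (cases "D_bar S x0 v0 i j") auto
    qed
  qed
qed

section \<open>Schedules read off from trajectories\<close>

lemma entry_time:
  assumes i: "(i, j) \<in> ops S x0" and u: "u \<in> signal_set (veh S j)" and x: "x0 j < \<alpha> S i j"
  shows "0 \<le> entry_time u i j" "position (veh S j) (entry_time u i j) u (x0 j) (v0 j) = \<alpha> S i j"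
  using crossing_time[OF op_vehicle(1)[OF ops_all_ops[OF i]] u op_vehicle(2)[OF ops_all_ops[OF i]],
    of "\<alpha> S i j"] x by (auto simp: entry_time_def)

lemma exit_time:
  assumes i: "(i, j) \<in> ops S x0" and u: "u \<in> signal_set (veh S j)"
  shows "0 \<le> exit_time u i j" "position (veh S j) (exit_time u i j) u (x0 j) (v0 j) = \<beta> S i j"
  using crossing_time[OF op_vehicle(1)[OF ops_all_ops[OF i]] u op_vehicle(2)[OF ops_all_ops[OF i]],
    of "\<beta> S i j"] ops_before_exit[OF i] by (auto simp: exit_time_def)

text \<open>
  All entry times of vehicle \<open>j\<close> are taken from its trajectory under one signal \<open>w j\<close>. This signal then
  satisfies the side conditions under which release time, deadline and process time are optimised, so
  that it is a competitor in each of these problems.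
\<close>

context
  fixes w :: "nat \<Rightarrow> real \<Rightarrow> real" and T :: "nat \<Rightarrow> nat \<Rightarrow> real"
  assumes w: "\<And>i j. (i, j) \<in> ops S x0 \<Longrightarrow> w j \<in> signal_set (veh S j)"
  defines "T \<equiv> \<lambda>i j. entry_time (w j) i j"
begin

lemma meets_entry_trajectory: "(i, j) \<in> ops S x0 \<Longrightarrow> meets_entry S x0 v0 T i j (w j)"
  using entry_time(2)[OF _ w] by (simp add: meets_entry_def T_def)

lemma trajectory_in_signals_from_pred:
  "(i, j) \<in> ops S x0 \<Longrightarrow> w j \<in> signals_from_pred S x0 v0 T i j"
  using w meets_entry_trajectory by (auto simp: signals_from_pred_def conj_arcs_def)

lemma is_schedule_trajectory: "is_schedule S x0 v0 T"
  using entry_time w unfolding is_schedule_def reachable_at_def T_def by blast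

lemma release_time_le_trajectory:
  assumes i: "(i, j) \<in> ops S x0"
  shows "release_time S x0 v0 T i j \<le> ereal (T i j)"
proof (cases "x0 j < \<alpha> S i j")
  case True
  note t = entry_time[OF i w[OF i] True]
  show ?thesis
    using earliest_le[OF trajectory_in_signals_from_pred[OF i] t] earliest_le[OF w[OF i] t] True
    by (simp add: release_time_def T_def)
next
  case False
  then show ?thesis
    using before_entry_of_later_op[OF i] by (auto simp: release_time_def T_def entry_time_def)
qed

lemma trajectory_le_deadline:
  assumes i: "(i, j) \<in> ops S x0"
  shows "ereal (T i j) \<le> deadline S x0 v0 T i j"
proof (cases "x0 j < \<alpha> S i j")
  case True
  note t = entry_time[OF i w[OF i] True]
  show ?thesis
    using le_latest[OF trajectory_in_signals_from_pred[OF i] t] le_latest[OF w[OF i] t] True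
    by (simp add: deadline_def T_def)
next
  case False
  then show ?thesis
    using before_entry_of_later_op[OF i] by (auto simp: deadline_def T_def entry_time_def)
qed

lemma process_time_le_exit_time:
  assumes i: "(i, j) \<in> ops S x0"
  shows "process_time S x0 v0 T i j \<le> ereal (exit_time (w j) i j)"
proof -
  have pos: "position (veh S j) (T l j) (w j) (x0 j) (v0 j) = \<alpha> S l j"
    if arc: "(i, l, j) \<in> conj_arcs S x0" for l
  proof -
    have l: "(l, j) \<in> ops S x0" "(l, j) \<notin> first_ops S x0"
      using arc by (auto simp: conj_arcs_def first_ops_def not_le)
    then show ?thesis
      using entry_time(2)[OF l(1) w[OF l(1)] before_entry_of_later_op[OF l]] by (simp add: T_def)
  qed
  show ?thesis
    unfolding process_time_def
    by (rule earliest_le[OF _ exit_time[OF i w[OF i]]])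
      (use w[OF i] meets_entry_trajectory[OF i] pos in auto)
qed

end

section \<open>Realising a solution of the upper bound problem\<close>

text \<open>
  For \<open>x0 j < \<alpha>_min S j\<close> the signal meets the scheduled first entry and continues with the maximal
  input; otherwise it is the maximal input, whose first entry time is the only one that is neither
  before \<open>R_bar\<close> nor after \<open>D_bar\<close>.
\<close>

lemma realising_signal:
  assumes feas: "upper_feasible S M x0 v0 TF k"
    and D: "\<And>i. (i, j) \<in> first_ops S x0 \<Longrightarrow> ereal (TF i j) \<le> D_bar S x0 v0 i j"
    and j: "(l, j) \<in> ops S x0"
  obtains u where "u \<in> signal_set (veh S j)"
    "\<And>i. (i, j) \<in> ops S x0 \<Longrightarrow> first_entry TF j + entry_delay i j \<le> entry_time u i j"
    "\<And>i. (i, j) \<in> ops S x0 \<Longrightarrow> exit_time u i j \<le> first_entry TF j + exit_delay i j"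
proof -
  note V = op_vehicle(1,2)[OF ops_all_ops[OF j]]
  note m = max_input_signal_in_signal_set[OF V(1)]
  note f = first_area_first_op[OF j]
  show thesis
  proof (cases "x0 j < \<alpha>_min S j")
    case x: True
    note \<alpha>f = first_entry_eq_\<alpha>_min[OF f x]
    have "reachable_at (veh S j) (x0 j) (v0 j) (\<alpha>_min S j) (first_entry TF j)"
      using feas f x \<alpha>f
      by (fastforce simp: upper_feasible_def is_first_schedule_def first_entry_def)
    then obtain u where u: "u \<in> signal_set (veh S j)"
      and t: "first_entry TF j = crossing_time (veh S j) u (x0 j) (v0 j) (\<alpha>_min S j)"
      using reachable_at_iff_crossing_time[OF V less_imp_le[OF x]] by blast
    have t0: "0 \<le> first_entry TF j" "position (veh S j) (first_entry TF j) u (x0 j) (v0 j) = \<alpha>_min S j"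
      using crossing_time[OF V(1) u V(2) less_imp_le[OF x]] t by auto
    note bounds = crossing_time_continue_at_max_input[OF V(1) u V(2) less_imp_le[OF x], folded t]
    let ?u = "switch_signal (first_entry TF j) u (max_input_signal (veh S j))"
    show thesis
    proof (rule that[of ?u])
      show "?u \<in> signal_set (veh S j)" by (rule switch_signal_in_signal_set[OF V(1) u m t0(1)])
      fix i
      assume i: "(i, j) \<in> ops S x0"
      note a = \<alpha>_min_le[OF ops_all_ops[OF i]]
      show "exit_time ?u i j \<le> first_entry TF j + exit_delay i j"
        using bounds(2)[of "\<beta> S i j"] x a op_vehicle(3)[OF ops_all_ops[OF i]]
        by (simp add: exit_time_def exit_delay_def)
      show "first_entry TF j + entry_delay i j \<le> entry_time ?u i j"
      proof (cases "(i, j) \<in> first_ops S x0")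
        case True
        have st: "is_state (veh S j) (\<alpha>_min S j) (speed_max (veh S j))"
          by (rule state_at_\<alpha>_min[OF ops_all_ops[OF i] x extreme_speeds(2)[OF V(1)]])
        have "0 \<le> full_throttle j (\<alpha>_min S j) (speed_max (veh S j)) (\<alpha>_min S j)"
          by (rule crossing_time(1)[OF V(1) m st]) simp
        then show ?thesis
          using bounds(1)[of "\<alpha>_min S j"] first_entry_eq_\<alpha>_min[OF True x] True x
          by (simp add: entry_delay_def entry_time_def)
      next
        case False
        then show ?thesis
          using bounds(1)[OF a] x a by (simp add: entry_delay_def entry_time_def)
      qed
    qed
  next
    case x: False
    have "earliest_first_entry j \<le> first_entry TF j"
      using feas f by (auto simp: upper_feasible_iff first_entry_def)
    moreover have "first_entry TF j \<le> earliest_first_entry j"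
      using D[OF f] D_bar_eq_R_bar[OF x] R_bar_eq[OF f] by (simp add: first_entry_def)
    ultimately have t: "first_entry TF j = earliest_first_entry j" by simp
    show thesis
    proof (rule that[OF m])
      fix i
      assume i: "(i, j) \<in> ops S x0"
      show "exit_time (max_input_signal (veh S j)) i j \<le> first_entry TF j + exit_delay i j"
        using x by (simp add: exit_time_def exit_delay_def t)
      show "first_entry TF j + entry_delay i j \<le> entry_time (max_input_signal (veh S j)) i j"
        using x before_entry_of_later_op[OF i] first_area_eq[of i j] t
        by (auto simp: entry_delay_def entry_time_def earliest_first_entry_def)
    qed
  qed
qed

text \<open>
  Along an arc, the exit time of \<open>j\<close> is at most \<open>P_bar\<close> and \<open>T_bar\<close> is at most the entry time of
  \<open>j'\<close>, so the constraint of the upper bound problem implies that of the jobshop problem.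
\<close>

lemma jobshop_optimum_of_upper_bound:
  assumes "upper_feasible S M x0 v0 TF k"
    and "\<And>i j. (i, j) \<in> first_ops S x0 \<Longrightarrow> ereal (TF i j) \<le> D_bar S x0 v0 i j"
  obtains T where "jobshop_feasible S M x0 v0 T k" "jobshop_objective S x0 v0 T \<le> 0"
proof -
  define realises where "realises j u \<longleftrightarrow> u \<in> signal_set (veh S j) \<and>
    (\<forall>i. (i, j) \<in> ops S x0 \<longrightarrow> first_entry TF j + entry_delay i j \<le> entry_time u i j \<and>
      exit_time u i j \<le> first_entry TF j + exit_delay i j)" for j u
  define w where "w j = (SOME u. realises j u)" for j
  have "realises j (w j)" if "(i, j) \<in> ops S x0" for i j
  proof -
    have "\<exists>u. realises j u"
      by (rule realising_signal[OF assms(1) assms(2) that]) (auto simp: realises_def)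
    then show ?thesis unfolding w_def by (rule someI_ex)
  qed
  then have w: "w j \<in> signal_set (veh S j)"
    and entry: "first_entry TF j + entry_delay i j \<le> entry_time (w j) i j"
    and exit: "exit_time (w j) i j \<le> first_entry TF j + exit_delay i j"
    if "(i, j) \<in> ops S x0" for i j
    using that by (auto simp: realises_def)
  define T where "T = (\<lambda>i j. entry_time (w j) i j)"
  show thesis
  proof (rule that)
    have "process_time S x0 v0 T i j \<le> ereal (T i j' + M * (1 - real (k i j j')))"
      if arc: "(i, j, j') \<in> disj_arcs S x0" for i j j'
    proof -
      have i: "(i, j) \<in> ops S x0" "(i, j') \<in> ops S x0" using arc by (auto simp: disj_arcs_def)
      have "process_time S x0 v0 T i j \<le> ereal (exit_time (w j) i j)"
        unfolding T_def by (rule process_time_le_exit_time[OF w i(1)])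
      moreover have "first_entry TF j + exit_delay i j
          \<le> first_entry TF j' + entry_delay i j' + M * (1 - real (k i j j'))"
        using assms(1) arc by (auto simp: upper_feasible_iff)
      then have "exit_time (w j) i j \<le> T i j' + M * (1 - real (k i j j'))"
        using exit[OF i(1)] entry[OF i(2)] unfolding T_def by linarith
      ultimately show ?thesis by (meson ereal_less_eq(3) order_trans)
    qed
    moreover have "is_order S x0 k" using assms(1) by (simp add: upper_feasible_def)
    moreover have "is_schedule S x0 v0 T"
      unfolding T_def by (rule is_schedule_trajectory[OF w])
    moreover have "release_time S x0 v0 T i j \<le> ereal (T i j)" if "(i, j) \<in> ops S x0" for i j
      unfolding T_def by (rule release_time_le_trajectory[OF w that])
    ultimately show "jobshop_feasible S M x0 v0 T k"
      using disj_arcs_sym unfolding jobshop_feasible_def by (simp add: Ball_def)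
    have "ereal (T i j) - deadline S x0 v0 T i j \<le> 0" if "(i, j) \<in> ops S x0" for i j
    proof -
      have "ereal (T i j) \<le> deadline S x0 v0 T i j"
        unfolding T_def by (rule trajectory_le_deadline[OF w that])
      then show ?thesis by (cases "deadline S x0 v0 T i j") auto
    qed
    then show "jobshop_objective S x0 v0 T \<le> 0"
      unfolding jobshop_objective_def by (subst Max_le_iff) (use finite_ops in auto)
  qed
qed

lemma jobshop_objective_nonneg: "0 \<le> jobshop_objective S x0 v0 T"
  unfolding jobshop_objective_def by (rule Max_ge) (use finite_ops in auto)

end

theorem theorem3:
  fixes S :: intersection and M :: real and x0 v0 :: "nat \<Rightarrow> real"
  assumes "is_intersection S"
    and "M > 0"
    and "initial_condition S x0 v0"
    and "s_U_star S M x0 v0 = 0"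
  shows "s_star S M x0 v0 = 0"
proof (rule antisym)
  interpret intersection_scenario S x0 v0
    using assms(1,3) by unfold_locales
  obtain TF k where TF: "upper_feasible S M x0 v0 TF k"
    "\<And>i j. (i, j) \<in> first_ops S x0 \<Longrightarrow> ereal (TF i j) \<le> D_bar S x0 v0 i j"
    using upper_bound_attained[OF assms(4)] by blast
  obtain T where T: "jobshop_feasible S M x0 v0 T k" "jobshop_objective S x0 v0 T \<le> 0"
    using jobshop_optimum_of_upper_bound[OF TF] by blast
  show "s_star S M x0 v0 \<le> 0"
    unfolding s_star_def by (rule order_trans[OF Inf_lower T(2)]) (use T(1) in blast)
  show "0 \<le> s_star S M x0 v0"
    unfolding s_star_def by (rule Inf_greatest) (use jobshop_objective_nonneg in blast)
qed

end
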